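(* Let $G$ be the toroidal $L$-grid with $n=L^2$ vertices and fix $\lambda>1$. For every positive integer $r\le L-2$, if $q\ge 2^{r^2+8r+3}r^{2r^2+4r+1}\lambda^{2+\frac2r}$, then for every $\varepsilon>0$, $$\tau(\mathcal{M}_{\mathrm{GD}}(G,\lambda,q),\varepsilon)\le 4(4\lambda^8)^{r^2+1}\,n^2\log(2en)\left(n\log(4\lambda^6)+\log(\varepsilon^{-1})\right).$$
   Context: The toroidal $L$-grid has vertex set $(\mathbb{Z}/L\mathbb{Z})^2$ with $(a,b)\sim(c,d)$ iff ($a-c=\pm1$ and $b=d$) or ($b-d=\pm1$ and $a=c$) in $\mathbb{Z}/L\mathbb{Z}$. Potts model: configurations $\sigma\in[q]^V$, $\mu(\sigma)$ = number of monochromatic edges, Gibbs distribution $\pi(\sigma)\propto\lambda^{\mu(\sigma)}$. Glauber dynamics $\mathcal{M}_{\mathrm{GD}}(G,\lambda,q)$: from $X_t$ choose a uniformly random vertex $v$, choose $c\in[q]$ with probability proportional to $\lambda^{n(X_t,v,c)}$ ($n(X,v,c)$ = number of neighbours of $v$ coloured $c$ in $X$), and recolour $v$ with $c$. $\tau(\mathcal{M},\varepsilon)=\max_x\min\{t:\|P^t(x,\cdot)-\pi\|_{TV}\le\varepsilon\}$.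
   Formalization: The bound is proved for 0 < ε < 1 instead of every ε > 0; for ε ≥ 1 the mixing time is 0, and for ε > (4λ^6)^n the right-hand side is negative, so the claim as written fails there. *)

theory Defs
  imports Complex_Main "HOL-Library.FuncSet"
begin

definition torus_V :: "nat \<Rightarrow> (nat \<times> nat) set" where
  "torus_V L = {..<L} \<times> {..<L}"

definition torus_adj :: "nat \<Rightarrow> nat \<times> nat \<Rightarrow> nat \<times> nat \<Rightarrow> bool" where
  "torus_adj L u v \<longleftrightarrow> u \<in> torus_V L \<and> v \<in> torus_V L \<and>
     (((fst u = (fst v + 1) mod L \<or> fst v = (fst u + 1) mod L) \<and> snd u = snd v) \<or>
      ((snd u = (snd v + 1) mod L \<or> snd v = (snd u + 1) mod L) \<and> fst u = fst v))"

definition torus_E :: "nat \<Rightarrow> (nat \<times> nat) set set" where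
  "torus_E L = {{u, v} | u v. torus_adj L u v}"

definition configs :: "nat \<Rightarrow> nat \<Rightarrow> (nat \<times> nat \<Rightarrow> nat) set" where
  "configs L q = PiE (torus_V L) (\<lambda>_. {..<q})"

definition mono_edges :: "nat \<Rightarrow> (nat \<times> nat \<Rightarrow> nat) \<Rightarrow> nat" where
  "mono_edges L \<sigma> = card {e \<in> torus_E L. \<exists>c. \<forall>u\<in>e. \<sigma> u = c}"

definition gibbs :: "nat \<Rightarrow> real \<Rightarrow> nat \<Rightarrow> (nat \<times> nat \<Rightarrow> nat) \<Rightarrow> real" where
  "gibbs L lam q \<sigma> = lam ^ mono_edges L \<sigma> / (\<Sum>\<tau>\<in>configs L q. lam ^ mono_edges L \<tau>)"

definition nbr_count :: "nat \<Rightarrow> (nat \<times> nat \<Rightarrow> nat) \<Rightarrow> nat \<times> nat \<Rightarrow> nat \<Rightarrow> nat" where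
  "nbr_count L X v c = card {u \<in> torus_V L. torus_adj L v u \<and> X u = c}"

definition glauber_P :: "nat \<Rightarrow> real \<Rightarrow> nat \<Rightarrow> (nat \<times> nat \<Rightarrow> nat) \<Rightarrow> (nat \<times> nat \<Rightarrow> nat) \<Rightarrow> real" where
  "glauber_P L lam q X Y =
     (1 / real (card (torus_V L))) *
     (\<Sum>v\<in>torus_V L. \<Sum>c<q.
        (if Y = X(v := c)
         then lam ^ nbr_count L X v c / (\<Sum>c'<q. lam ^ nbr_count L X v c')
         else 0))"

fun glauber_Pt :: "nat \<Rightarrow> real \<Rightarrow> nat \<Rightarrow> nat \<Rightarrow> (nat \<times> nat \<Rightarrow> nat) \<Rightarrow> (nat \<times> nat \<Rightarrow> nat) \<Rightarrow> real" where
  "glauber_Pt L lam q 0 X Y = (if X = Y then 1 else 0)"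
| "glauber_Pt L lam q (Suc t) X Y =
     (\<Sum>Z\<in>configs L q. glauber_Pt L lam q t X Z * glauber_P L lam q Z Y)"

definition tv_dist :: "nat \<Rightarrow> real \<Rightarrow> nat \<Rightarrow> nat \<Rightarrow> (nat \<times> nat \<Rightarrow> nat) \<Rightarrow> real" where
  "tv_dist L lam q t X = (1/2) * (\<Sum>Y\<in>configs L q. \<bar>glauber_Pt L lam q t X Y - gibbs L lam q Y\<bar>)"

definition mixing_time :: "nat \<Rightarrow> real \<Rightarrow> nat \<Rightarrow> real \<Rightarrow> nat" where
  "mixing_time L lam q \<epsilon> =
     Max ((\<lambda>X. LEAST t. tv_dist L lam q t X \<le> \<epsilon>) ` configs L q)"

end

theory Submission
  imports Defs
begin

text \<open>
  Consider the heat-bath dynamics on the \<open>r \<times> r\<close> blocks of the torus. Let \<open>S\<close> be the set of vertices of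
  a block that carry a given colour. Counting row by row and column by column, at most \<open>(2 + 2/r) |S|\<close>
  monochromatic edges meet \<open>S\<close>, so recolouring \<open>S\<close> freely shows that this set has conditional
  probability at most \<open>x ^ |S|\<close> with \<open>x = \<lambda> powr (2 + 2/r) / q\<close>, whatever the boundary condition.
  Hence with probability close to 1 the block avoids both colours involved in a change of one boundary
  spin, and the block dynamics contracts Lipschitz constants by the factor \<open>1 - r\<^sup>2/(2n)\<close>.

  By reversibility, contraction of Lipschitz constants is contraction in \<open>L\<^sup>2\<close> at the same rate, that is
  a spectral gap of the block dynamics. Comparing a block with a product measure bounds its variance by
  \<open>\<lambda> ^ (4r\<^sup>2)\<close> times the sum of its single-site variances, which gives a gap for the Glauber dynamics
  and, if \<open>q < 128 \<lambda>\<^sup>4\<close>, the mixing time bound. For \<open>q \<ge> 128 \<lambda>\<^sup>4\<close> the blocks with \<open>r = 1\<close> already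
  contract, and the resulting bound does not depend on \<open>q\<close>.
\<close>

section \<open>Conditional expectations on finite product spaces\<close>

text \<open>Blocks are used for the sake of the exponent: a single site lies on 4 edges, whereas a
  full square of side \<open>r\<close> in a larger torus meets \<open>2 * r^2 + 2 * r\<close> edges,
  that is, \<open>2 + 2 / r\<close> per site. The price is paid when the update of a block is traded
  for updates of its sites.

  Contraction is stated for operators acting on functions, the dual form of path coupling. No
  coupling has to be constructed, and one estimate serves both regimes of \<open>q\<close>.

  Two regimes arise because the target bound does not mention \<open>q\<close>. Passing from
  \<open>L^2\<close> to total variation costs the square root of the inverse of the least Gibbs
  probability, for which the bound is a power of \<open>q * lam^2\<close>; this is affordable while
  \<open>q\<close> is bounded by a power of \<open>lam\<close>. For larger \<open>q\<close>,
  pointwise contraction loses only a factor \<open>n\<close>.\<close>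

locale spin_space =
  fixes I :: "'i set" and A :: "'a set"
  assumes finite_I: "finite I" and finite_A: "finite A"
begin

definition Om :: "('i \<Rightarrow> 'a) set" where
  "Om = PiE I (\<lambda>_. A)"

definition cls :: "'i set \<Rightarrow> ('i \<Rightarrow> 'a) \<Rightarrow> ('i \<Rightarrow> 'a) set" where
  "cls B X = {Y \<in> Om. \<forall>u. u \<notin> B \<longrightarrow> Y u = X u}"

text \<open>Conditional expectation given the spins outside \<open>B\<close>, that is, one heat-bath
  update of \<open>B\<close>. Being a quotient in \<open>w\<close>, it lets the weight stay
  unnormalised throughout.\<close>

definition cexp :: "(('i \<Rightarrow> 'a) \<Rightarrow> real) \<Rightarrow> 'i set \<Rightarrow> (('i \<Rightarrow> 'a) \<Rightarrow> real) \<Rightarrow> ('i \<Rightarrow> 'a) \<Rightarrow> real" where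
  "cexp w B f X = (\<Sum>Y\<in>cls B X. w Y * f Y) / (\<Sum>Y\<in>cls B X. w Y)"

definition ip :: "(('i \<Rightarrow> 'a) \<Rightarrow> real) \<Rightarrow> (('i \<Rightarrow> 'a) \<Rightarrow> real) \<Rightarrow> (('i \<Rightarrow> 'a) \<Rightarrow> real) \<Rightarrow> real" where
  "ip w f g = (\<Sum>X\<in>Om. w X * f X * g X)"

definition positive :: "(('i \<Rightarrow> 'a) \<Rightarrow> real) \<Rightarrow> bool" where
  "positive w \<longleftrightarrow> (\<forall>X\<in>Om. 0 < w X)"

text \<open>Measurability with respect to the spins outside \<open>B\<close>.\<close>

definition invariant :: "'i set \<Rightarrow> (('i \<Rightarrow> 'a) \<Rightarrow> real) \<Rightarrow> bool" where
  "invariant B h \<longleftrightarrow> (\<forall>X\<in>Om. \<forall>Y\<in>cls B X. h Y = h X)"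

text \<open>Lipschitz continuity for the Hamming distance, tested on changes of one site as in path
  coupling.\<close>

definition lip :: "(('i \<Rightarrow> 'a) \<Rightarrow> real) \<Rightarrow> real \<Rightarrow> bool" where
  "lip f l \<longleftrightarrow> (\<forall>v\<in>I. \<forall>X\<in>Om. \<forall>Y\<in>cls {v} X. \<bar>f X - f Y\<bar> \<le> l)"

text \<open>Transition operator of the dynamics that picks \<open>p\<close> uniformly from
  \<open>J\<close> and resamples \<open>B p\<close>. The blocks \<open>{v}\<close> give the Glauber
  dynamics.\<close>

definition block_avg ::
  "(('i \<Rightarrow> 'a) \<Rightarrow> real) \<Rightarrow> 'p set \<Rightarrow> ('p \<Rightarrow> 'i set) \<Rightarrow> (('i \<Rightarrow> 'a) \<Rightarrow> real) \<Rightarrow> ('i \<Rightarrow> 'a) \<Rightarrow> real" where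
  "block_avg w J B f X = (\<Sum>p\<in>J. cexp w (B p) f X) / real (card J)"

lemma finite_Om [simp]: "finite Om"
  unfolding Om_def using finite_I finite_A by (intro finite_PiE) auto

lemma cls_subset: "cls B X \<subseteq> Om"
  by (auto simp: cls_def)

lemma finite_cls [simp]: "finite (cls B X)"
  using cls_subset finite_Om by (rule finite_subset)

lemma clsI: "Y \<in> Om \<Longrightarrow> (\<And>u. u \<notin> B \<Longrightarrow> Y u = X u) \<Longrightarrow> Y \<in> cls B X"
  by (simp add: cls_def)

lemma cls_outside: "Y \<in> cls B X \<Longrightarrow> u \<notin> B \<Longrightarrow> Y u = X u"
  by (simp add: cls_def)

lemma cls_refl: "X \<in> Om \<Longrightarrow> X \<in> cls B X"
  by (auto simp: cls_def)

lemma cls_sym: "X \<in> Om \<Longrightarrow> Y \<in> cls B X \<Longrightarrow> X \<in> cls B Y"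
  by (auto simp: cls_def)

lemma cls_eq: "Y \<in> cls B X \<Longrightarrow> cls B Y = cls B X"
  by (auto simp: cls_def)

lemma sum_cls_pos:
  assumes "positive w" "X \<in> Om"
  shows "0 < (\<Sum>Y\<in>cls B X. w Y)"
  using assms cls_refl[OF assms(2), of B] cls_subset[of B X]
  by (intro sum_pos) (auto simp: positive_def)

lemma cexp_invariant: "invariant B (cexp w B f)"
  by (auto simp: invariant_def cexp_def dest: cls_eq)

lemma cexp_mult_invariant:
  assumes "positive w" "invariant B h" "X \<in> Om"
  shows "cexp w B (\<lambda>Y. h Y * f Y) X = h X * cexp w B f X"
proof -
  have "(\<Sum>Y\<in>cls B X. w Y * (h Y * f Y)) = h X * (\<Sum>Y\<in>cls B X. w Y * f Y)"
    using assms by (auto simp: invariant_def sum_distrib_left intro!: sum.cong)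
  then show ?thesis by (simp add: cexp_def)
qed

lemma cexp_of_invariant:
  assumes "positive w" "invariant B h" "X \<in> Om"
  shows "cexp w B h X = h X"
proof -
  have "cexp w B (\<lambda>_. 1) X = 1"
    using sum_cls_pos[OF assms(1,3), of B] by (simp add: cexp_def)
  then show ?thesis
    using cexp_mult_invariant[OF assms, of "\<lambda>_. 1"] by simp
qed

lemma cexp_diff: "cexp w B (\<lambda>Y. f Y - g Y) X = cexp w B f X - cexp w B g X"
  by (simp add: cexp_def right_diff_distrib sum_subtractf diff_divide_distrib)

section \<open>Conditional expectations as orthogonal projections\<close>

lemma ip_cong:
  "\<lbrakk>\<And>X. X \<in> Om \<Longrightarrow> f X = f' X; \<And>X. X \<in> Om \<Longrightarrow> g X = g' X\<rbrakk> \<Longrightarrow> ip w f g = ip w f' g'"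
  by (simp add: ip_def)

lemma ip_commute: "ip w f g = ip w g f"
  by (simp add: ip_def mult_ac)

lemma ip_nonneg: "positive w \<Longrightarrow> 0 \<le> ip w f f"
  unfolding ip_def positive_def mult.assoc
  by (intro sum_nonneg mult_nonneg_nonneg[OF _ zero_le_square]) (auto intro: less_imp_le)

lemma ip_add_square:
  "ip w (\<lambda>X. f X + g X) (\<lambda>X. f X + g X) = ip w f f + 2 * ip w f g + ip w g g"
proof -
  have "w X * (f X + g X) * (f X + g X)
      = w X * f X * f X + 2 * (w X * f X * g X) + w X * g X * g X" for X
    by (simp add: algebra_simps)
  then show ?thesis by (simp add: ip_def sum.distrib sum_distrib_left)
qed

lemma ip_diff_right: "ip w f (\<lambda>X. g X - h X) = ip w f g - ip w f h"
  by (simp add: ip_def right_diff_distrib sum_subtractf)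

lemma ip_diff_left: "ip w (\<lambda>X. g X - h X) f = ip w g f - ip w h f"
  by (simp add: ip_def algebra_simps sum_subtractf)

text \<open>Detailed balance: two configurations of one class share the normaliser \<open>Z\<close>,
  so the kernel \<open>T\<close> is unchanged when the functions and the configurations are
  exchanged together.\<close>

lemma ip_cexp_sym:
  assumes "positive w"
  shows "ip w (cexp w B f) g = ip w f (cexp w B g)"
proof -
  define Z where "Z = (\<lambda>X. \<Sum>Y\<in>cls B X. w Y)"
  define T where "T = (\<lambda>f g X Y. if Y \<in> cls B X then w X * w Y * f Y * g X / Z X else 0)"
  have 1: "ip w (cexp w B f) g = (\<Sum>X\<in>Om. \<Sum>Y\<in>Om. T f g X Y)" for f g
    unfolding ip_def
  proof (rule sum.cong[OF refl])
    fix X assume "X \<in> Om"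
    have "(\<Sum>Y\<in>Om. T f g X Y) = (\<Sum>Y\<in>cls B X. w X * w Y * f Y * g X / Z X)"
      unfolding T_def using cls_subset[of B X]
      by (subst sum.inter_restrict[symmetric]) (auto intro!: sum.cong simp: inf.absorb2)
    also have "\<dots> = w X * cexp w B f X * g X"
      by (simp add: cexp_def Z_def sum_distrib_left sum_distrib_right sum_divide_distrib mult_ac)
    finally show "w X * cexp w B f X * g X = (\<Sum>Y\<in>Om. T f g X Y)" ..
  qed
  have 2: "T f g X Y = T g f Y X" if "X \<in> Om" "Y \<in> Om" for X Y
  proof (cases "Y \<in> cls B X")
    case True
    then have "X \<in> cls B Y" "Z Y = Z X"
      using cls_sym[OF that(1)] cls_eq[OF True] by (auto simp: Z_def)
    then show ?thesis using True by (simp add: T_def mult_ac)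
  next
    case False
    then have "X \<notin> cls B Y" using cls_sym[OF that(2)] by blast
    then show ?thesis using False by (simp add: T_def)
  qed
  have "ip w (cexp w B f) g = (\<Sum>X\<in>Om. \<Sum>Y\<in>Om. T g f Y X)"
    unfolding 1 by (intro sum.cong refl 2)
  also have "\<dots> = ip w (cexp w B g) f"
    unfolding 1 by (rule sum.swap)
  finally show ?thesis using ip_commute by metis
qed

lemma ip_cexp_cexp:
  assumes "positive w"
  shows "ip w (cexp w B f) (cexp w B g) = ip w f (cexp w B g)"
proof -
  have "ip w (cexp w B f) (cexp w B g) = ip w f (cexp w B (cexp w B g))"
    by (rule ip_cexp_sym[OF assms])
  also have "\<dots> = ip w f (cexp w B g)"
    by (intro ip_cong refl cexp_of_invariant assms cexp_invariant)
  finally show ?thesis .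
qed

text \<open>Pythagoras. Up to normalisation the right-hand side is the mean conditional variance of
  \<open>f\<close>, the Dirichlet form in which blocks and sites are compared later.\<close>

lemma ip_cexp_residual:
  assumes "positive w"
  shows "ip w (\<lambda>X. f X - cexp w B f X) (\<lambda>X. f X - cexp w B f X) = ip w f f - ip w f (cexp w B f)"
  using ip_cexp_cexp[OF assms, of B f f]
  by (simp add: ip_diff_left ip_diff_right ip_commute[of w "cexp w B f" f])

text \<open>Subtracting \<open>h\<close> does not change the residual, since \<open>cexp w B\<close>
  fixes \<open>h\<close>; by Pythagoras the residual of \<open>f - h\<close> is no longer than
  \<open>f - h\<close> itself.\<close>

lemma cexp_best_approximation:
  assumes "positive w" "invariant B h"
  shows "ip w (\<lambda>X. f X - cexp w B f X) (\<lambda>X. f X - cexp w B f X)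
    \<le> ip w (\<lambda>X. f X - h X) (\<lambda>X. f X - h X)"
proof -
  let ?u = "\<lambda>X. f X - h X"
  have "ip w (\<lambda>X. f X - cexp w B f X) (\<lambda>X. f X - cexp w B f X)
      = ip w (\<lambda>X. ?u X - cexp w B ?u X) (\<lambda>X. ?u X - cexp w B ?u X)"
    using cexp_of_invariant[OF assms] by (intro ip_cong) (auto simp: cexp_diff)
  also have "\<dots> = ip w ?u ?u - ip w (cexp w B ?u) (cexp w B ?u)"
    using assms(1) by (simp add: ip_cexp_residual ip_cexp_cexp)
  also have "\<dots> \<le> ip w ?u ?u"
    using ip_nonneg[OF assms(1)] by simp
  finally show ?thesis .
qed

lemma cexp_contraction:
  assumes "positive w"
  shows "ip w (cexp w B f) (cexp w B f) \<le> ip w f f"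
  using ip_nonneg[OF assms, of "\<lambda>X. f X - cexp w B f X"]
  by (simp add: ip_cexp_residual[OF assms] ip_cexp_cexp[OF assms])

section \<open>Single-site updates\<close>

lemma cls_singleton:
  assumes "v \<in> I" "X \<in> Om"
  shows "cls {v} X = (\<lambda>c. X(v := c)) ` A"
proof (intro equalityI subsetI)
  fix Y assume Y: "Y \<in> cls {v} X"
  then have "Y = X(v := Y v)" "Y v \<in> A"
    using assms by (auto simp: cls_def Om_def PiE_def Pi_def)
  then show "Y \<in> (\<lambda>c. X(v := c)) ` A" by blast
next
  fix Y assume "Y \<in> (\<lambda>c. X(v := c)) ` A"
  then show "Y \<in> cls {v} X"
    using assms by (auto simp: cls_def Om_def PiE_def Pi_def extensional_def)
qed

lemma inj_upd: "inj_on (\<lambda>c. X(v := c)) S"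
  by (metis fun_upd_same inj_onI)

lemma cexp_singleton:
  assumes "v \<in> I" "X \<in> Om"
  shows "cexp w {v} f X = (\<Sum>c\<in>A. w (X(v := c)) * f (X(v := c))) / (\<Sum>c\<in>A. w (X(v := c)))"
  unfolding cexp_def cls_singleton[OF assms] by (simp add: sum.reindex[OF inj_upd])

lemma upd_in_Om: "v \<in> I \<Longrightarrow> X \<in> Om \<Longrightarrow> c \<in> A \<Longrightarrow> X(v := c) \<in> Om"
  using cls_singleton[of v X] cls_subset[of "{v}" X] by blast

lemma upd_in_cls:
  "v \<in> I \<Longrightarrow> Y \<in> cls B X \<Longrightarrow> c \<in> A \<Longrightarrow> Y(v := c) \<in> cls B (X(v := c))"
  using upd_in_Om[of v Y c] by (auto simp: cls_def)

lemma Om_val: "X \<in> Om \<Longrightarrow> v \<in> I \<Longrightarrow> X v \<in> A"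
  by (auto simp: Om_def)

section \<open>Comparison of a block with its sites\<close>

lemma invariant_insert:
  assumes "v \<in> I" "invariant B h" "invariant {v} h"
  shows "invariant (insert v B) h"
  unfolding invariant_def
proof (intro ballI)
  fix X Y assume X: "X \<in> Om" and Y: "Y \<in> cls (insert v B) X"
  \<comment> \<open>Resetting \<open>v\<close> first leaves a change inside \<open>B\<close>
    only.\<close>
  let ?Z = "Y(v := X v)"
  have Z: "?Z \<in> cls B X" and YZ: "Y \<in> cls {v} ?Z"
    using X Y upd_in_Om[OF assms(1), of Y "X v"] Om_val[OF X assms(1)] by (auto simp: cls_def)
  have "?Z \<in> Om" using Z cls_subset by blast
  then have "h Y = h ?Z" "h ?Z = h X"
    using assms(2,3) X Z YZ unfolding invariant_def by blast+
  then show "h Y = h X" by simp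
qed

text \<open>A change inside \<open>B\<close> before the update at \<open>v\<close> is still one
  after it, and neither \<open>m\<close> nor \<open>h\<close> sees it. With a weight that varies
  inside the classes of \<open>B\<close> this can fail, which is why the comparison passes through
  an invariant weight.\<close>

lemma cexp_preserves_invariant:
  assumes "v \<in> I" "invariant B m" "invariant B h"
  shows "invariant B (cexp m {v} h)"
  unfolding invariant_def
proof (intro ballI)
  fix X Y assume X: "X \<in> Om" and Y: "Y \<in> cls B X"
  then have YO: "Y \<in> Om" using cls_subset by auto
  have eq: "g (Y(v := c)) = g (X(v := c))" if "invariant B g" "c \<in> A" for g c
    using that upd_in_Om[OF assms(1) X] upd_in_cls[OF assms(1) Y] by (auto simp: invariant_def)
  show "cexp m {v} h Y = cexp m {v} h X"
    using assms by (simp add: cexp_singleton X YO eq cong: sum.cong)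
qed

lemma invariant_mono: "invariant B h \<Longrightarrow> C \<subseteq> B \<Longrightarrow> invariant C h"
  unfolding invariant_def cls_def by blast

text \<open>For a weight that is constant on the classes of \<open>B\<close>, the conditional expectations at the sites of
  \<open>B\<close> are uniform averages, which preserve invariance at the other sites.\<close>

lemma invariant_tensorization:
  assumes "positive m" "finite B" "B \<subseteq> I" "invariant B m"
  shows "\<exists>h. invariant B h \<and> ip m (\<lambda>X. f X - h X) (\<lambda>X. f X - h X)
    \<le> (\<Sum>v\<in>B. ip m (\<lambda>X. f X - cexp m {v} f X) (\<lambda>X. f X - cexp m {v} f X))"
  using assms(2-)
proof (induction B rule: finite_induct)
  case empty
  have "invariant {} f"
    by (auto simp: invariant_def cls_def) (metis ext)
  then show ?case by (intro exI[of _ f]) (simp add: ip_def)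
next
  case (insert v B)
  have mB: "invariant B m" and v: "v \<in> I" and BI: "B \<subseteq> I"
    using insert.prems invariant_mono[of "insert v B" m B] by auto
  obtain h where h: "invariant B h" "ip m (\<lambda>X. f X - h X) (\<lambda>X. f X - h X)
    \<le> (\<Sum>v\<in>B. ip m (\<lambda>X. f X - cexp m {v} f X) (\<lambda>X. f X - cexp m {v} f X))"
    using insert.IH[OF BI mB] by blast
  let ?U = "cexp m {v}"
  let ?g = "\<lambda>X. f X - h X" and ?e = "\<lambda>X. f X - ?U f X"
  \<comment> \<open>The witness for the larger set is \<open>?U h\<close>. Its error splits into the
    residual \<open>?e\<close> of the update at \<open>v\<close> and \<open>?U ?g\<close>, which are
    orthogonal; the latter is no longer than \<open>?g\<close>, so no constant is lost.\<close>
  have "ip m (\<lambda>X. f X - ?U h X) (\<lambda>X. f X - ?U h X)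
     = ip m (\<lambda>X. ?e X + ?U ?g X) (\<lambda>X. ?e X + ?U ?g X)"
    by (intro ip_cong) (auto simp: cexp_diff)
  also have "\<dots> = ip m ?e ?e + 2 * ip m ?e (?U ?g) + ip m (?U ?g) (?U ?g)"
    by (rule ip_add_square)
  also have "ip m ?e (?U ?g) = 0"
    by (simp add: ip_diff_left ip_cexp_cexp[OF assms(1)])
  also have "ip m (?U ?g) (?U ?g) \<le> ip m ?g ?g"
    by (rule cexp_contraction[OF assms(1)])
  finally have "ip m (\<lambda>X. f X - ?U h X) (\<lambda>X. f X - ?U h X) \<le> ip m ?e ?e + ip m ?g ?g"
    by simp
  also have "\<dots> \<le> (\<Sum>v\<in>insert v B. ip m (\<lambda>X. f X - cexp m {v} f X) (\<lambda>X. f X - cexp m {v} f X))"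
    unfolding sum.insert[OF insert(1,2)] using h(2) by (rule add_left_mono)
  finally have "ip m (\<lambda>X. f X - ?U h X) (\<lambda>X. f X - ?U h X)
    \<le> (\<Sum>v\<in>insert v B. ip m (\<lambda>X. f X - cexp m {v} f X) (\<lambda>X. f X - cexp m {v} f X))" .
  moreover have "invariant (insert v B) (?U h)"
    by (rule invariant_insert[OF v cexp_preserves_invariant[OF v mB h(1)] cexp_invariant])
  ultimately show ?case
    by blast
qed

text \<open>Holley-Stroock perturbation. On each class \<open>w\<close> lies between its minimum
  \<open>m\<close> and \<open>K * m\<close>, and \<open>m\<close> makes the conditional law of the
  block uniform, hence a product. The factor \<open>K\<close> is paid once, for the block; the
  return from \<open>m\<close> to \<open>w\<close> at the sites uses only
  \<open>m X \<le> w X\<close>.\<close>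

lemma block_comparison:
  assumes w: "positive w" and B: "B \<subseteq> I"
    and K: "\<And>X Y. X \<in> Om \<Longrightarrow> Y \<in> cls B X \<Longrightarrow> w X \<le> K * w Y"
  shows "ip w f f - ip w f (cexp w B f) \<le> K * (\<Sum>v\<in>B. ip w f f - ip w f (cexp w {v} f))"
proof (cases "Om = {}")
  case True
  then have "ip w f g = 0" for f g by (simp add: ip_def)
  then show ?thesis by simp
next
  case False
  define m where "m = (\<lambda>X. Min (w ` cls B X))"
  have m_le: "m X \<le> w X" if "X \<in> Om" for X
    unfolding m_def by (intro Min_le finite_imageI finite_cls imageI cls_refl that)
  have m_in: "m X \<in> w ` cls B X" if "X \<in> Om" for X
    unfolding m_def using cls_refl[OF that] by (intro Min_in finite_imageI finite_cls) blast
  have m_pos: "positive m"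
    unfolding positive_def
  proof
    fix X assume "X \<in> Om"
    from m_in[OF this] show "0 < m X" using w cls_subset[of B X] by (auto simp: positive_def)
  qed
  have m_inv: "invariant B m"
    by (simp add: invariant_def m_def cls_eq)
  have w_le: "w X \<le> K * m X" if "X \<in> Om" for X
  proof -
    from m_in[OF that] obtain Y where "Y \<in> cls B X" "m X = w Y" by blast
    then show ?thesis using K[OF that(1)] by simp
  qed
  obtain X0 where "X0 \<in> Om" using False by auto
  then have "0 < K"
    using w_le[of X0] m_pos w unfolding positive_def by (meson less_le_trans zero_less_mult_pos2)
  obtain h where h: "invariant B h" "ip m (\<lambda>X. f X - h X) (\<lambda>X. f X - h X)
    \<le> (\<Sum>v\<in>B. ip m (\<lambda>X. f X - cexp m {v} f X) (\<lambda>X. f X - cexp m {v} f X))"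
    using invariant_tensorization[OF m_pos finite_subset[OF B finite_I] B m_inv] by blast
  \<comment> \<open>The function \<open>h\<close> was built for \<open>m\<close>, but like any
    invariant function it competes in the best approximation under \<open>w\<close>.\<close>
  have "ip w f f - ip w f (cexp w B f) \<le> ip w (\<lambda>X. f X - h X) (\<lambda>X. f X - h X)"
    using cexp_best_approximation[OF w h(1)] by (simp add: ip_cexp_residual[OF w])
  also have "\<dots> \<le> K * ip m (\<lambda>X. f X - h X) (\<lambda>X. f X - h X)"
    unfolding ip_def sum_distrib_left mult.assoc[symmetric] unfolding mult.assoc[of _ "f _ - h _"]
    using w_le by (intro sum_mono mult_right_mono) auto
  also have "ip m (\<lambda>X. f X - h X) (\<lambda>X. f X - h X)
      \<le> (\<Sum>v\<in>B. ip m (\<lambda>X. f X - cexp m {v} f X) (\<lambda>X. f X - cexp m {v} f X))"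
    by (rule h(2))
  also have "\<dots> \<le> (\<Sum>v\<in>B. ip w f f - ip w f (cexp w {v} f))"
  proof (rule sum_mono)
    fix v assume "v \<in> B"
    let ?e = "\<lambda>X. f X - cexp w {v} f X"
    \<comment> \<open>The same principle with the weights exchanged: \<open>cexp w {v} f\<close>
      competes under \<open>m\<close>.\<close>
    have "ip m (\<lambda>X. f X - cexp m {v} f X) (\<lambda>X. f X - cexp m {v} f X) \<le> ip m ?e ?e"
      by (intro cexp_best_approximation m_pos cexp_invariant)
    also have "\<dots> \<le> ip w ?e ?e"
      unfolding ip_def mult.assoc using m_le by (intro sum_mono mult_right_mono) auto
    finally show "ip m (\<lambda>X. f X - cexp m {v} f X) (\<lambda>X. f X - cexp m {v} f X)
      \<le> ip w f f - ip w f (cexp w {v} f)"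
      by (simp add: ip_cexp_residual[OF w])
  qed
  finally show ?thesis using \<open>0 < K\<close> by simp
qed

end

section \<open>Lipschitz contraction and spectral gap\<close>

text \<open>The quotients of a log-convex sequence increase. If the first one,
  \<open>\<theta>\<close>, exceeded \<open>s\<close>, the sequence would grow at least like
  \<open>\<theta> ^ t\<close> and outrun \<open>C * s ^ t\<close>, however large \<open>C\<close>
  is.\<close>

lemma log_convex_ratio_le:
  fixes a :: "nat \<Rightarrow> real"
  assumes nn: "\<And>t. 0 \<le> a t"
    and lc: "\<And>t. (a (Suc t))\<^sup>2 \<le> a t * a (Suc (Suc t))"
    and up: "\<And>t. a t \<le> C * s ^ t" and s: "0 < s"
  shows "a 1 \<le> s * a 0"
proof (rule ccontr)
  assume "\<not> a 1 \<le> s * a 0"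
  then have gt: "s * a 0 < a 1" by simp
  have a1: "0 < a 1" using gt s nn[of 0] mult_nonneg_nonneg[of s "a 0"] by linarith
  have a0: "0 < a 0"
    using lc[of 0] a1 nn[of 0] by (cases "a 0 = 0") auto
  define \<theta> where "\<theta> = a 1 / a 0"
  have \<theta>: "s < \<theta>" using gt a0 by (simp add: \<theta>_def field_simps)
  have step: "0 < a t \<and> \<theta> * a t \<le> a (Suc t)" for t
  proof (induction t)
    case 0
    then show ?case using a0 by (simp add: \<theta>_def)
  next
    case (Suc t)
    have pos: "0 < a (Suc t)"
      using Suc \<theta> s mult_pos_pos[of \<theta> "a t"] by linarith
    have "a t * (\<theta> * a (Suc t)) \<le> a (Suc t) * a (Suc t)"
      using Suc pos by (simp add: mult_ac)
    also have "\<dots> \<le> a t * a (Suc (Suc t))"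
      using lc[of t] by (simp add: power2_eq_square)
    finally show ?case using Suc pos by simp
  qed
  have low: "\<theta> ^ t * a 0 \<le> a t" for t
  proof (induction t)
    case (Suc t)
    have "\<theta> ^ Suc t * a 0 = \<theta> * (\<theta> ^ t * a 0)" by simp
    also have "\<dots> \<le> \<theta> * a t" using Suc \<theta> s by (intro mult_left_mono) auto
    also have "\<dots> \<le> a (Suc t)" using step by blast
    finally show ?case .
  qed simp
  obtain t where "C / a 0 < (\<theta> / s) ^ t"
    using real_arch_pow[of "\<theta> / s" "C / a 0"] \<theta> s by auto
  then have "C * s ^ t < \<theta> ^ t * a 0"
    using a0 s by (simp add: power_divide field_simps)
  then show False using low[of t] up[of t] by simp
qed

context spin_space
begin

definition centered :: "(('i \<Rightarrow> 'a) \<Rightarrow> real) \<Rightarrow> (('i \<Rightarrow> 'a) \<Rightarrow> real) \<Rightarrow> bool" where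
  "centered w f \<longleftrightarrow> (\<Sum>X\<in>Om. w X * f X) = 0"

lemma ip_Cauchy_Schwarz:
  assumes "positive w"
  shows "(ip w f g)\<^sup>2 \<le> ip w f f * ip w g g"
proof (cases "ip w g g = 0")
  case True
  have "0 \<le> w X * g X * g X" if "X \<in> Om" for X
    using assms that mult_nonneg_nonneg[OF less_imp_le zero_le_square, of "w X" "g X"]
    by (simp add: positive_def mult.assoc)
  then have "\<forall>X\<in>Om. w X * g X * g X = 0"
    using True unfolding ip_def by (simp add: sum_nonneg_eq_0_iff)
  then have "ip w f g = 0"
    using assms unfolding ip_def positive_def by (intro sum.neutral) force
  then show ?thesis using True by simp
next
  case False
  let ?a = "ip w g g" and ?b = "ip w f g"
  have a: "0 < ?a" using False ip_nonneg[OF assms, of g] by simp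
  have sc: "ip w (\<lambda>X. c * u X) v = c * ip w u v" "ip w u (\<lambda>X. c * v X) = c * ip w u v" for c u v
    by (simp_all add: ip_def sum_distrib_left mult_ac)
  have "0 \<le> ip w (\<lambda>X. ?a * f X - ?b * g X) (\<lambda>X. ?a * f X - ?b * g X)"
    by (rule ip_nonneg[OF assms])
  also have "\<dots> = ?a * (ip w f f * ?a - ?b\<^sup>2)"
    by (simp add: ip_diff_left ip_diff_right sc ip_commute[of w g f]) (simp add: algebra_simps power2_eq_square)
  finally show ?thesis using a by (simp add: zero_le_mult_iff)
qed

lemma cls_full: "X \<in> Om \<Longrightarrow> cls I X = Om"
  by (auto simp: cls_def Om_def PiE_def extensional_def)

lemma lip_cls_bound:
  assumes f: "lip f l" and X: "X \<in> Om" and "finite B" "B \<subseteq> I" "Y \<in> cls B X"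
  shows "\<bar>f X - f Y\<bar> \<le> real (card B) * l"
  using assms(3-)
proof (induction B arbitrary: Y rule: finite_induct)
  case empty
  then have "Y = X" by (auto simp: cls_def)
  then show ?case by simp
next
  case (insert v B)
  let ?Z = "Y(v := X v)"
  have v: "v \<in> I" using insert by auto
  have Z: "?Z \<in> cls B X" and YZ: "Y \<in> cls {v} ?Z"
    using X insert.prems upd_in_Om[OF v, of Y "X v"] Om_val[OF X v] by (auto simp: cls_def)
  have "\<bar>f X - f ?Z\<bar> \<le> real (card B) * l"
    using insert.prems by (intro insert.IH[OF _ Z]) blast
  moreover have "\<bar>f ?Z - f Y\<bar> \<le> l"
    using f v Z YZ cls_subset[of B X] unfolding lip_def by blast
  ultimately show ?case using insert by (simp add: algebra_simps)
qed

lemma lip_oscillation: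
  assumes "lip f l" "X \<in> Om" "Y \<in> Om"
  shows "\<bar>f X - f Y\<bar> \<le> real (card I) * l"
  using lip_cls_bound[OF assms(1,2) finite_I order_refl] cls_full[OF assms(2)] assms(3) by simp

lemma lip_mean_deviation:
  assumes w: "positive w" and f: "lip f l" and X: "X \<in> Om"
  shows "\<bar>f X - (\<Sum>Y\<in>Om. w Y * f Y) / (\<Sum>Y\<in>Om. w Y)\<bar> \<le> real (card I) * l"
proof -
  let ?W = "\<Sum>Y\<in>Om. w Y"
  have W: "0 < ?W" using sum_cls_pos[OF w X, of I] by (simp add: cls_full[OF X])
  have "\<bar>f X * ?W - (\<Sum>Y\<in>Om. w Y * f Y)\<bar> = \<bar>\<Sum>Y\<in>Om. w Y * (f X - f Y)\<bar>"
    by (simp add: right_diff_distrib sum_subtractf sum_distrib_left mult_ac)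
  also have "\<dots> \<le> (\<Sum>Y\<in>Om. w Y * (real (card I) * l))"
    using w lip_oscillation[OF f X]
    by (intro order_trans[OF sum_abs] sum_mono) (auto simp: abs_mult positive_def intro!: mult_mono)
  also have "\<dots> = ?W * (real (card I) * l)"
    by (simp add: sum_distrib_right)
  finally have "\<bar>f X * ?W - (\<Sum>Y\<in>Om. w Y * f Y)\<bar> / ?W \<le> real (card I) * l"
    using W by (simp add: divide_le_eq mult_ac)
  also have "\<bar>f X * ?W - (\<Sum>Y\<in>Om. w Y * f Y)\<bar> / ?W = \<bar>(f X * ?W - (\<Sum>Y\<in>Om. w Y * f Y)) / ?W\<bar>"
    using W by (simp add: abs_divide)
  also have "(f X * ?W - (\<Sum>Y\<in>Om. w Y * f Y)) / ?W = f X - (\<Sum>Y\<in>Om. w Y * f Y) / ?W"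
    using W by (simp add: diff_divide_distrib)
  finally show ?thesis .
qed

text \<open>Apart from the Lipschitz constant nothing on the right depends on \<open>f\<close>, so
  decay of Lipschitz constants along iterates passes to norms.\<close>

lemma lip_centered_bound:
  assumes w: "positive w" and f: "lip f l" and c: "centered w f"
  shows "ip w f f \<le> (real (card I) * l)\<^sup>2 * (\<Sum>X\<in>Om. w X)"
proof -
  have "w X * f X * f X \<le> w X * (real (card I) * l)\<^sup>2" if X: "X \<in> Om" for X
  proof -
    have "\<bar>f X\<bar> \<le> real (card I) * l"
      using lip_mean_deviation[OF w f X] c by (simp add: centered_def)
    then have "(f X)\<^sup>2 \<le> (real (card I) * l)\<^sup>2"
      by (metis abs_ge_zero power2_abs power_mono)
    then show ?thesis
      using w X by (auto simp: positive_def power2_eq_square mult.assoc)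
  qed
  then have "ip w f f \<le> (\<Sum>X\<in>Om. w X * (real (card I) * l)\<^sup>2)"
    unfolding ip_def by (rule sum_mono)
  then show ?thesis by (simp add: sum_distrib_right mult.commute)
qed

section \<open>The averaging operator: symmetry, stationarity, spectral gap\<close>

lemma ip_block_avg: "ip w f (block_avg w J B g) = (\<Sum>p\<in>J. ip w f (cexp w (B p) g)) / real (card J)"
proof -
  have "ip w f (block_avg w J B g)
      = (\<Sum>X\<in>Om. (\<Sum>p\<in>J. w X * f X * cexp w (B p) g X)) / real (card J)"
    by (simp add: ip_def block_avg_def sum_distrib_left sum_divide_distrib)
  also have "(\<Sum>X\<in>Om. (\<Sum>p\<in>J. w X * f X * cexp w (B p) g X)) = (\<Sum>p\<in>J. ip w f (cexp w (B p) g))"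
    unfolding ip_def by (rule sum.swap)
  finally show ?thesis .
qed

lemma block_avg_sym:
  assumes "positive w"
  shows "ip w (block_avg w J B f) g = ip w f (block_avg w J B g)"
proof -
  have "ip w g (cexp w (B p) f) = ip w f (cexp w (B p) g)" for p
    using ip_cexp_sym[OF assms] ip_commute by metis
  then show ?thesis
    unfolding ip_commute[of w "block_avg w J B f"] ip_block_avg by presburger
qed

lemma block_avg_one:
  assumes "positive w" "finite J" "J \<noteq> {}" "X \<in> Om"
  shows "block_avg w J B (\<lambda>_. 1) X = 1"
  using assms cexp_of_invariant[of w _ "\<lambda>_. 1" X]
  by (simp add: block_avg_def invariant_def)

lemma block_avg_mean:
  assumes w: "positive w" and J: "finite J" "J \<noteq> {}"
  shows "(\<Sum>X\<in>Om. w X * block_avg w J B f X) = (\<Sum>X\<in>Om. w X * f X)"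
proof -
  have "ip w (block_avg w J B f) (\<lambda>_. 1) = ip w f (\<lambda>_. 1)"
    unfolding block_avg_sym[OF w] by (intro ip_cong) (simp_all add: block_avg_one[OF w J])
  then show ?thesis by (simp add: ip_def)
qed

lemma block_avg_centered:
  assumes "positive w" "finite J" "J \<noteq> {}" "centered w f"
  shows "centered w (block_avg w J B f)"
  using assms by (simp add: centered_def block_avg_mean)

lemma lip_exists: "\<exists>l\<ge>0. lip f l"
proof (intro exI conjI)
  let ?l = "2 * (\<Sum>X\<in>Om. \<bar>f X\<bar>)"
  show "0 \<le> ?l" by (simp add: sum_nonneg)
  have le: "\<bar>f X\<bar> \<le> (\<Sum>X\<in>Om. \<bar>f X\<bar>)" if "X \<in> Om" for X
    using that by (intro member_le_sum) auto
  have "\<bar>f X - f Y\<bar> \<le> ?l" if "X \<in> Om" "Y \<in> Om" for X Y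
    using le[OF that(1)] le[OF that(2)] by linarith
  then show "lip f ?l"
    unfolding lip_def using cls_subset by blast
qed

text \<open>Symmetry and Cauchy-Schwarz make the squared norms \<open>a t\<close> of the iterates
  log-convex, so their first quotient is at most their asymptotic rate, which the Lipschitz
  constants bound by \<open>\<rho>^2\<close>. This does the work of a diagonalisation; the crude
  prefactor of the norm bound does not affect the rate.\<close>

lemma lip_contraction_imp_gap:
  assumes w: "positive w" and J: "finite J" "J \<noteq> {}" and \<rho>: "0 < \<rho>"
    and contr: "\<And>f l. 0 \<le> l \<Longrightarrow> lip f l \<Longrightarrow> lip (block_avg w J B f) (\<rho> * l)"
    and f: "centered w f"
  shows "ip w f (block_avg w J B f) \<le> \<rho> * ip w f f"
proof -
  let ?P = "block_avg w J B"
  define F where "F t = (?P ^^ t) f" for t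
  define a where "a t = ip w (F t) (F t)" for t
  have FS: "F (Suc t) = ?P (F t)" for t by (simp add: F_def)
  obtain l where l: "0 \<le> l" "lip f l" using lip_exists by blast
  have lipF: "lip (F t) (\<rho> ^ t * l)" for t
  proof (induction t)
    case 0
    then show ?case using l by (simp add: F_def)
  next
    case (Suc t)
    then show ?case using contr[of "\<rho> ^ t * l" "F t"] \<rho> l by (simp add: FS mult_ac)
  qed
  have cF: "centered w (F t)" for t
    by (induction t) (simp_all add: F_def f block_avg_centered[OF w J])
  have "a 1 \<le> \<rho>\<^sup>2 * a 0"
  proof (rule log_convex_ratio_le)
    show "0 \<le> a t" for t by (simp add: a_def ip_nonneg[OF w])
    show "(a (Suc t))\<^sup>2 \<le> a t * a (Suc (Suc t))" for t
    proof -
      have "a (Suc t) = ip w (F t) (F (Suc (Suc t)))"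
        by (simp add: a_def FS block_avg_sym[OF w])
      then show ?thesis using ip_Cauchy_Schwarz[OF w] by (simp add: a_def)
    qed
    show "a t \<le> ((real (card I) * l)\<^sup>2 * (\<Sum>X\<in>Om. w X)) * (\<rho>\<^sup>2) ^ t" for t
      using lip_centered_bound[OF w lipF cF, of t]
      by (simp add: a_def power_mult_distrib mult_ac flip: power_mult)
    show "0 < \<rho>\<^sup>2" using \<rho> by simp
  qed
  then have a1: "ip w (?P f) (?P f) \<le> \<rho>\<^sup>2 * ip w f f"
    by (simp add: a_def F_def)
  have "(ip w f (?P f))\<^sup>2 \<le> ip w f f * ip w (?P f) (?P f)"
    by (rule ip_Cauchy_Schwarz[OF w])
  also have "\<dots> \<le> ip w f f * (\<rho>\<^sup>2 * ip w f f)"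
    using a1 ip_nonneg[OF w, of f] by (rule mult_left_mono)
  also have "\<dots> = (\<rho> * ip w f f)\<^sup>2"
    by (simp add: power2_eq_square)
  finally show ?thesis
    by (rule power2_le_imp_le) (use \<rho> ip_nonneg[OF w, of f] in simp)
qed

text \<open>An average \<open>P\<close> of projections satisfies \<open>P^2 \<le> P\<close>: the
  squared norms of \<open>?E p - ?P\<close>, summed over the blocks, are nonnegative. Hence negative
  eigenvalues do not arise, and a bound on the quadratic form alone controls the iterates.\<close>

lemma ip_block_avg_block_avg_le:
  assumes w: "positive w" and J: "finite J" "J \<noteq> {}"
  shows "ip w (block_avg w J B f) (block_avg w J B f) \<le> ip w f (block_avg w J B f)"
proof -
  let ?P = "block_avg w J B f" and ?E = "\<lambda>p. cexp w (B p) f" and ?n = "real (card J)"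
  have n: "0 < ?n" using J by (simp add: card_gt_0_iff)
  have s1: "(\<Sum>p\<in>J. ip w f (?E p)) = ?n * ip w f ?P"
    using n by (simp add: ip_block_avg)
  have s2: "(\<Sum>p\<in>J. ip w ?P (?E p)) = ?n * ip w ?P ?P"
    using n by (simp add: ip_block_avg[of w ?P J B f])
  have "0 \<le> (\<Sum>p\<in>J. ip w (\<lambda>X. ?E p X - ?P X) (\<lambda>X. ?E p X - ?P X))"
    by (intro sum_nonneg ip_nonneg w)
  also have "\<dots> = (\<Sum>p\<in>J. ip w f (?E p) - 2 * ip w ?P (?E p) + ip w ?P ?P)"
  proof (rule sum.cong[OF refl])
    fix p
    have "ip w (?E p) ?P = ip w ?P (?E p)" by (rule ip_commute)
    then show "ip w (\<lambda>X. ?E p X - ?P X) (\<lambda>X. ?E p X - ?P X)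
        = ip w f (?E p) - 2 * ip w ?P (?E p) + ip w ?P ?P"
      by (simp add: ip_diff_left ip_diff_right ip_cexp_cexp[OF w])
  qed
  also have "\<dots> = ?n * ip w f ?P - ?n * ip w ?P ?P"
    by (simp add: sum.distrib sum_subtractf s1 s2 flip: sum_distrib_left)
  finally show ?thesis using n by simp
qed

lemma gap_imp_decay:
  assumes w: "positive w" and J: "finite J" "J \<noteq> {}" and \<rho>: "0 \<le> \<rho>"
    and gap: "\<And>f. centered w f \<Longrightarrow> ip w f (block_avg w J B f) \<le> \<rho> * ip w f f"
    and f: "centered w f"
  shows "ip w ((block_avg w J B ^^ t) f) ((block_avg w J B ^^ t) f) \<le> \<rho> ^ t * ip w f f"
proof -
  let ?P = "block_avg w J B"
  have c: "centered w ((?P ^^ t) f)" for t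
    by (induction t) (simp_all add: f block_avg_centered[OF w J])
  show ?thesis
  proof (induction t)
    case (Suc t)
    have "ip w ((?P ^^ Suc t) f) ((?P ^^ Suc t) f) \<le> \<rho> * ip w ((?P ^^ t) f) ((?P ^^ t) f)"
      using ip_block_avg_block_avg_le[OF w J, of B "(?P ^^ t) f"] gap[OF c[of t]] by simp
    also have "\<dots> \<le> \<rho> * (\<rho> ^ t * ip w f f)"
      using Suc \<rho> by (rule mult_left_mono)
    finally show ?case by (simp add: mult_ac)
  qed simp
qed

text \<open>Double counting: summing the block comparison over \<open>J\<close> charges each site
  once for each of the \<open>d\<close> blocks containing it. This \<open>d\<close> cancels against
  the one in the block gap, and \<open>card J = card I\<close> cancels the two
  normalisations.\<close>

lemma block_gap_imp_single_site_gap: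
  assumes w: "positive w" and I: "I \<noteq> {}" and J: "finite J" "card J = card I"
    and B: "\<And>p. p \<in> J \<Longrightarrow> B p \<subseteq> I"
    and d: "\<And>v. v \<in> I \<Longrightarrow> card {p \<in> J. v \<in> B p} = d" and d0: "0 < d" and K0: "0 < K"
    and K: "\<And>p X Y. p \<in> J \<Longrightarrow> X \<in> Om \<Longrightarrow> Y \<in> cls (B p) X \<Longrightarrow> w X \<le> K * w Y"
    and gap: "ip w f (block_avg w J B f) \<le> (1 - real d * \<kappa>) * ip w f f"
  shows "ip w f (block_avg w I (\<lambda>v. {v}) f) \<le> (1 - \<kappa> / K) * ip w f f"
proof -
  let ?n = "real (card I)" and ?D = "\<lambda>v. ip w f f - ip w f (cexp w {v} f)"
  let ?G = "block_avg w I (\<lambda>v. {v})"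
  have n: "0 < ?n" using I finite_I by (simp add: card_gt_0_iff)
  have "real d * \<kappa> * ip w f f \<le> ip w f f - ip w f (block_avg w J B f)"
    using gap by (simp add: algebra_simps)
  then have "?n * (real d * \<kappa> * ip w f f) \<le> ?n * (ip w f f - ip w f (block_avg w J B f))"
    using n by simp
  also have "\<dots> = (\<Sum>p\<in>J. ip w f f - ip w f (cexp w (B p) f))"
    using n J by (simp add: ip_block_avg sum_subtractf right_diff_distrib)
  also have "\<dots> \<le> (\<Sum>p\<in>J. K * (\<Sum>v\<in>B p. ?D v))"
    by (intro sum_mono block_comparison w B K)
  also have "\<dots> = K * (\<Sum>p\<in>J. \<Sum>v\<in>I. if v \<in> B p then ?D v else 0)"
  proof -
    have "(\<Sum>v\<in>B p. ?D v) = (\<Sum>v\<in>I. if v \<in> B p then ?D v else 0)" if "p \<in> J" for p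
      using B[OF that] sum.inter_restrict[OF finite_I, of ?D "B p"] by (simp add: inf.absorb2)
    then show ?thesis unfolding sum_distrib_left[symmetric] by simp
  qed
  also have "\<dots> = K * (\<Sum>v\<in>I. \<Sum>p\<in>J. if v \<in> B p then ?D v else 0)"
    by (simp only: sum.swap[of _ J I])
  also have "\<dots> = K * (\<Sum>v\<in>I. real d * ?D v)"
    using d J by (simp add: sum.inter_filter[symmetric])
  also have "\<dots> = K * (real d * (?n * (ip w f f - ip w f (?G f))))"
    using n by (simp add: ip_block_avg sum_subtractf right_diff_distrib flip: sum_distrib_left)
  finally have "(?n * real d) * (\<kappa> * ip w f f) \<le> (?n * real d) * (K * (ip w f f - ip w f (?G f)))"
    by (simp add: mult_ac)
  then have "\<kappa> * ip w f f \<le> K * (ip w f f - ip w f (?G f))"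
    using n d0 by (subst (asm) mult_le_cancel_left_pos) auto
  then show ?thesis using K0 by (simp add: field_simps)
qed

section \<open>Effect of a single spin on a block update\<close>

lemma block_avg_lip:
  assumes "finite J" "J \<noteq> {}" and "0 \<le> l"
    and c: "\<And>v X Y p. v \<in> I \<Longrightarrow> X \<in> Om \<Longrightarrow> Y \<in> cls {v} X \<Longrightarrow> p \<in> J \<Longrightarrow>
      \<bar>cexp w (B p) f X - cexp w (B p) f Y\<bar> \<le> l * c v p"
    and s: "\<And>v. v \<in> I \<Longrightarrow> (\<Sum>p\<in>J. c v p) \<le> \<rho> * real (card J)"
  shows "lip (block_avg w J B f) (\<rho> * l)"
  unfolding lip_def
proof (intro ballI)
  fix v X Y assume v: "v \<in> I" and X: "X \<in> Om" and Y: "Y \<in> cls {v} X"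
  have n: "0 < real (card J)" using assms by (simp add: card_gt_0_iff)
  have "\<bar>block_avg w J B f X - block_avg w J B f Y\<bar>
     = \<bar>\<Sum>p\<in>J. cexp w (B p) f X - cexp w (B p) f Y\<bar> / real (card J)"
    by (simp add: block_avg_def sum_subtractf flip: diff_divide_distrib)
  also have "\<dots> \<le> (\<Sum>p\<in>J. l * c v p) / real (card J)"
    by (intro divide_right_mono order_trans[OF sum_abs] sum_mono c v X Y) auto
  also have "\<dots> = l * (\<Sum>p\<in>J. c v p) / real (card J)"
    by (simp add: sum_distrib_left)
  also have "\<dots> \<le> l * (\<rho> * real (card J)) / real (card J)"
    using s[OF v] assms(3) by (intro divide_right_mono mult_left_mono) auto
  finally show "\<bar>block_avg w J B f X - block_avg w J B f Y\<bar> \<le> \<rho> * l"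
    using n by (simp add: mult_ac)
qed

lemma cexp_same_class:
  assumes "v \<in> B" "Y \<in> cls {v} X"
  shows "cexp w B f Y = cexp w B f X"
proof -
  have "Y \<in> cls B X" using assms by (auto simp: cls_def)
  then show ?thesis by (simp add: cexp_def cls_eq)
qed

text \<open>Overwriting \<open>v\<close> transports both conditional laws to one space. Outside
  \<open>Bad\<close> their weights are proportional, and the scalar between them is controlled by
  the masses of \<open>Bad\<close>. The l1 distance is at most \<open>\<delta>\<close> outside
  \<open>Bad\<close> and \<open>2 * \<delta>\<close> on it, whence the constant 3.\<close>

lemma cexp_boundary_change:
  assumes w: "positive w" and v: "v \<in> I" and X: "X \<in> Om" and Y: "Y \<in> cls {v} X"
    and B: "B \<subseteq> I" "v \<notin> B" and f: "lip f l" and l: "0 \<le> l"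
    and Bad: "Bad \<subseteq> cls B X"
    and good: "\<And>s. s \<in> cls B X \<Longrightarrow> s \<notin> Bad \<Longrightarrow> w (s(v := Y v)) = a * w s"
    and b1: "(\<Sum>s\<in>Bad. w s) \<le> \<delta> * (\<Sum>s\<in>cls B X. w s)"
    and b2: "(\<Sum>s\<in>Bad. w (s(v := Y v))) \<le> \<delta> * (\<Sum>s\<in>cls B Y. w s)"
  shows "\<bar>cexp w B f X - cexp w B f Y\<bar> \<le> l * (1 + 3 * \<delta> * real (card B))"
proof -
  let ?C = "cls B X" and ?\<phi> = "\<lambda>s. s(v := Y v)"
  have YO: "Y \<in> Om" using Y cls_subset by blast
  have finB: "finite B" using B finite_I finite_subset by blast
  have CO: "s \<in> Om" if "s \<in> ?C" for s using that cls_subset by blast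
  have \<phi>in: "?\<phi> s \<in> cls B Y" if "s \<in> ?C" for s
    using upd_in_cls[OF v that, of "Y v"] Y Om_val[OF YO v] by (auto simp: cls_def)
  have \<phi>O: "?\<phi> s \<in> Om" if "s \<in> ?C" for s using \<phi>in[OF that] cls_subset by blast
  have inj: "inj_on ?\<phi> ?C"
  proof (rule inj_onI, rule ext)
    fix s t u assume s: "s \<in> ?C" and t: "t \<in> ?C" and eq: "?\<phi> s = ?\<phi> t"
    show "s u = t u"
    proof (cases "u = v")
      case True then show ?thesis using s t B(2) by (auto simp: cls_def)
    next
      case False then show ?thesis using fun_cong[OF eq, of u] by simp
    qed
  qed
  have img: "?\<phi> ` ?C = cls B Y"
  proof (intro equalityI subsetI)
    fix t assume t: "t \<in> cls B Y"
    have "t(v := X v) \<in> ?C"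
      using t Y upd_in_Om[OF v _ Om_val[OF X v]] cls_subset[of B Y]
      by (auto simp: cls_def)
    moreover have "?\<phi> (t(v := X v)) = t"
      using t B(2) by (auto simp: cls_def)
    ultimately show "t \<in> ?\<phi> ` ?C" by (metis image_eqI)
  qed (use \<phi>in in auto)
  define Z Z' where "Z = (\<Sum>s\<in>?C. w s)" and "Z' = (\<Sum>s\<in>cls B Y. w s)"
  have Zp: "0 < Z" "0 < Z'" unfolding Z_def Z'_def using sum_cls_pos[OF w] X YO by auto
  have Z'eq: "Z' = (\<Sum>s\<in>?C. w (?\<phi> s))"
    unfolding Z'_def img[symmetric] by (simp add: sum.reindex[OF inj])
  define p p' where "p s = w s / Z" and "p' s = w (?\<phi> s) / Z'" for s
  have pn: "0 \<le> p s" "0 \<le> p' s" if "s \<in> ?C" for s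
    using w CO[OF that] \<phi>O[OF that] Zp by (auto simp: p_def p'_def positive_def less_imp_le)
  have p1: "(\<Sum>s\<in>?C. p s) = 1" "(\<Sum>s\<in>?C. p' s) = 1"
    using Zp by (simp_all add: p_def p'_def Z_def Z'eq flip: sum_divide_distrib)
  have eX: "cexp w B f X = (\<Sum>s\<in>?C. p s * f s)"
    by (simp add: cexp_def p_def Z_def sum_divide_distrib)
  have eY: "cexp w B f Y = (\<Sum>s\<in>?C. p' s * f (?\<phi> s))"
    unfolding cexp_def Z'_def[symmetric] img[symmetric] p'_def
    by (simp add: sum.reindex[OF inj] sum_divide_distrib Z'eq)
  have pBad: "(\<Sum>s\<in>Bad. p s) \<le> \<delta>" "(\<Sum>s\<in>Bad. p' s) \<le> \<delta>"
    using b1 b2 Zp by (simp_all add: p_def p'_def Z_def Z'_def divide_le_eq flip: sum_divide_distrib)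
  have split: "(\<Sum>s\<in>?C. g s) = (\<Sum>s\<in>?C - Bad. g s) + (\<Sum>s\<in>Bad. g s)" for g :: "_ \<Rightarrow> real"
    by (rule sum.subset_diff[OF Bad finite_cls])
  define \<alpha> where "\<alpha> = a * Z / Z'"
  have p'\<alpha>: "p' s = \<alpha> * p s" if "s \<in> ?C - Bad" for s
    using good that Zp by (simp add: p_def p'_def \<alpha>_def)
  \<comment> \<open>No two terms have opposite signs, all being multiples of
    \<open>1 - \<alpha>\<close>, so the absolute value comes out of the sum. Both laws have mass 1,
    so what remains is the difference of the masses of \<open>Bad\<close>.\<close>
  have "(\<Sum>s\<in>?C - Bad. \<bar>p s - p' s\<bar>) = \<bar>\<Sum>s\<in>?C - Bad. p s - p' s\<bar>"
  proof -
    have eq: "p s - p' s = (1 - \<alpha>) * p s" if "s \<in> ?C - Bad" for s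
      using p'\<alpha>[OF that] by (simp add: algebra_simps)
    have "(\<Sum>s\<in>?C - Bad. \<bar>p s - p' s\<bar>) = (\<Sum>s\<in>?C - Bad. \<bar>1 - \<alpha>\<bar> * p s)"
      using pn by (intro sum.cong refl) (simp add: eq abs_mult)
    also have "\<dots> = \<bar>1 - \<alpha>\<bar> * \<bar>\<Sum>s\<in>?C - Bad. p s\<bar>"
      using pn by (subst abs_of_nonneg[OF sum_nonneg]) (auto simp: sum_distrib_left)
    also have "\<dots> = \<bar>\<Sum>s\<in>?C - Bad. (1 - \<alpha>) * p s\<bar>"
      by (simp add: abs_mult flip: sum_distrib_left)
    also have "\<dots> = \<bar>\<Sum>s\<in>?C - Bad. p s - p' s\<bar>"
      using eq by (intro arg_cong[where f=abs] sum.cong) auto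
    finally show ?thesis .
  qed
  also have "(\<Sum>s\<in>?C - Bad. p s - p' s) = (\<Sum>s\<in>Bad. p' s) - (\<Sum>s\<in>Bad. p s)"
    using p1 split[of p] split[of p'] by (simp add: sum_subtractf)
  also have "\<bar>\<dots>\<bar> \<le> \<delta>"
  proof -
    have "0 \<le> (\<Sum>s\<in>Bad. p s)" "0 \<le> (\<Sum>s\<in>Bad. p' s)"
      using pn Bad by (auto intro!: sum_nonneg)
    then show ?thesis using pBad by linarith
  qed
  finally have G: "(\<Sum>s\<in>?C - Bad. \<bar>p s - p' s\<bar>) \<le> \<delta>" .
  have "(\<Sum>s\<in>Bad. \<bar>p s - p' s\<bar>) \<le> (\<Sum>s\<in>Bad. p s + p' s)"
  proof (rule sum_mono)
    fix s assume "s \<in> Bad"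
    then show "\<bar>p s - p' s\<bar> \<le> p s + p' s" using pn[of s] Bad by auto
  qed
  also have "\<dots> \<le> 2 * \<delta>" using pBad by (simp add: sum.distrib)
  finally have tv: "(\<Sum>s\<in>?C. \<bar>p s - p' s\<bar>) \<le> 3 * \<delta>"
    using G split[of "\<lambda>s. \<bar>p s - p' s\<bar>"] by simp
  \<comment> \<open>In the first sum only the spin at \<open>v\<close> changes, at cost
    \<open>l\<close>. In the second the law changes; \<open>f Y\<close> may be subtracted because
    \<open>p - p'\<close> has total mass 0, and it leaves an oscillation of at most
    \<open>card B * l\<close>.\<close>
  have "cexp w B f X - cexp w B f Y
      = (\<Sum>s\<in>?C. p s * (f s - f (?\<phi> s))) + (\<Sum>s\<in>?C. (p s - p' s) * (f (?\<phi> s) - f Y))"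
  proof -
    have "(\<Sum>s\<in>?C. (p s - p' s) * (f (?\<phi> s) - f Y))
       = (\<Sum>s\<in>?C. (p s - p' s) * f (?\<phi> s)) - (\<Sum>s\<in>?C. (p s - p' s)) * f Y"
      unfolding right_diff_distrib sum_subtractf[of "\<lambda>s. (p s - p' s) * f (?\<phi> s)"] sum_distrib_right ..
    also have "(\<Sum>s\<in>?C. (p s - p' s)) = 0" using p1 by (simp add: sum_subtractf)
    finally show ?thesis unfolding eX eY
      by (simp add: left_diff_distrib right_diff_distrib sum_subtractf)
  qed
  also have "\<bar>\<dots>\<bar> \<le> (\<Sum>s\<in>?C. p s * l) + (\<Sum>s\<in>?C. \<bar>p s - p' s\<bar> * (real (card B) * l))"
  proof (rule order_trans[OF abs_triangle_ineq], rule add_mono)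
    show "\<bar>\<Sum>s\<in>?C. p s * (f s - f (?\<phi> s))\<bar> \<le> (\<Sum>s\<in>?C. p s * l)"
    proof (rule order_trans[OF sum_abs], rule sum_mono)
      fix s assume s: "s \<in> ?C"
      have "?\<phi> s \<in> cls {v} s" using \<phi>O[OF s] by (simp add: cls_def)
      then have "\<bar>f s - f (?\<phi> s)\<bar> \<le> l" using f v CO[OF s] by (simp add: lip_def)
      then show "\<bar>p s * (f s - f (?\<phi> s))\<bar> \<le> p s * l"
        using pn[OF s] by (simp add: abs_mult mult_left_mono)
    qed
    show "\<bar>\<Sum>s\<in>?C. (p s - p' s) * (f (?\<phi> s) - f Y)\<bar>
      \<le> (\<Sum>s\<in>?C. \<bar>p s - p' s\<bar> * (real (card B) * l))"
    proof (rule order_trans[OF sum_abs], rule sum_mono)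
      fix s assume s: "s \<in> ?C"
      have "\<bar>f (?\<phi> s) - f Y\<bar> \<le> real (card B) * l"
        using lip_cls_bound[OF f YO finB B(1) \<phi>in[OF s]] by (simp add: abs_minus_commute)
      then show "\<bar>(p s - p' s) * (f (?\<phi> s) - f Y)\<bar> \<le> \<bar>p s - p' s\<bar> * (real (card B) * l)"
        by (simp add: abs_mult mult_left_mono)
    qed
  qed
  also have "\<dots> = l + (\<Sum>s\<in>?C. \<bar>p s - p' s\<bar>) * (real (card B) * l)"
    using p1 by (simp flip: sum_distrib_right)
  also have "\<dots> \<le> l + 3 * \<delta> * (real (card B) * l)"
    using tv l by (intro add_left_mono mult_right_mono) auto
  finally show ?thesis by (simp add: algebra_simps)
qed

end

section \<open>Edges of the torus\<close>

text \<open>Together with \<open>up\<close> this orients the torus: every edge is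
  \<open>{u, rt L u}\<close> or \<open>{u, up L u}\<close>, so edges can be counted through two
  injective shifts.\<close>

definition rt :: "nat \<Rightarrow> nat \<times> nat \<Rightarrow> nat \<times> nat" where
  "rt L u = ((fst u + 1) mod L, snd u)"

definition up :: "nat \<Rightarrow> nat \<times> nat \<Rightarrow> nat \<times> nat" where
  "up L u = (fst u, (snd u + 1) mod L)"

definition block :: "nat \<Rightarrow> nat \<Rightarrow> nat \<times> nat \<Rightarrow> (nat \<times> nat) set" where
  "block L r p = (\<lambda>(k, j). ((fst p + k) mod L, (snd p + j) mod L)) ` ({..<r} \<times> {..<r})"

section \<open>Shifts modulo \<open>L\<close> and block incidences\<close>

lemma mod_shift_unique:
  fixes a k v L :: nat
  assumes "a < L" "k \<le> L" "(a + k) mod L = v"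
  shows "a = (v + (L - k)) mod L"
proof -
  have "(v + (L - k)) mod L = (a + k + (L - k)) mod L"
    unfolding assms(3)[symmetric] by (rule mod_add_left_eq)
  also have "\<dots> = a" using assms by simp
  finally show ?thesis ..
qed

lemma mod_shift_inj:
  fixes a b k L :: nat
  assumes "a < L" "b < L" "k \<le> L" "(a + k) mod L = (b + k) mod L"
  shows "a = b"
  using mod_shift_unique[OF assms(1,3) assms(4)] mod_shift_unique[OF assms(2,3) refl] by simp

lemma card_mod_shift:
  fixes v L r :: nat
  assumes "v < L" "r \<le> L"
  shows "card {a. a < L \<and> (\<exists>k<r. (a + k) mod L = v)} = r"
proof -
  let ?g = "\<lambda>k. (v + (L - k)) mod L"
  have rev_shift: "(?g k + k) mod L = v" if "k < r" for k
    using that assms by (simp add: mod_add_left_eq)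
  have "{a. a < L \<and> (\<exists>k<r. (a + k) mod L = v)} = ?g ` {..<r}"
  proof (intro equalityI subsetI)
    fix a assume "a \<in> {a. a < L \<and> (\<exists>k<r. (a + k) mod L = v)}"
    then obtain k where "a < L" "k < r" "(a + k) mod L = v" by blast
    then show "a \<in> ?g ` {..<r}" using mod_shift_unique[of a L k v] assms by auto
  next
    fix a assume "a \<in> ?g ` {..<r}"
    then show "a \<in> {a. a < L \<and> (\<exists>k<r. (a + k) mod L = v)}" using rev_shift assms by auto
  qed
  moreover have "inj_on ?g {..<r}"
  proof (rule inj_onI)
    fix k k' assume k: "k \<in> {..<r}" "k' \<in> {..<r}" and eq: "?g k = ?g k'"
    have "(k + ?g k) mod L = (k' + ?g k) mod L"
      using rev_shift[of k] rev_shift[of k'] k eq by (simp add: add.commute)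
    then show "k = k'"
      using k assms by (intro mod_shift_inj[of k L k' "?g k"]) auto
  qed
  ultimately show ?thesis by (simp add: card_image)
qed

lemma finite_torus_V [simp]: "finite (torus_V L)"
  by (simp add: torus_V_def)

lemma card_torus_V: "card (torus_V L) = L\<^sup>2"
  by (simp add: torus_V_def card_cartesian_product power2_eq_square)

lemma block_subset: "0 < L \<Longrightarrow> block L r p \<subseteq> torus_V L"
  by (auto simp: block_def torus_V_def)

lemma finite_block [simp]: "finite (block L r p)"
  by (simp add: block_def)

lemma card_block_le: "card (block L r p) \<le> r\<^sup>2"
  using card_image_le[of "{..<r} \<times> {..<r}"]
  by (simp add: block_def card_cartesian_product power2_eq_square)

lemma card_blocks_containing:
  assumes "v \<in> torus_V L" "r \<le> L"
  shows "card {p \<in> torus_V L. v \<in> block L r p} = r\<^sup>2"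
proof -
  have "{p \<in> torus_V L. v \<in> block L r p}
    = {a. a < L \<and> (\<exists>k<r. (a + k) mod L = fst v)} \<times> {a. a < L \<and> (\<exists>k<r. (a + k) mod L = snd v)}"
    (is "_ = ?S (fst v) \<times> ?S (snd v)")
  proof (rule set_eqI)
    fix p
    have "v \<in> block L r p \<longleftrightarrow> (\<exists>k<r. (fst p + k) mod L = fst v) \<and> (\<exists>j<r. (snd p + j) mod L = snd v)"
      unfolding block_def image_iff prod_eq_iff Bex_def split_paired_Ex by simp metis
    then show "p \<in> {p \<in> torus_V L. v \<in> block L r p} \<longleftrightarrow> p \<in> ?S (fst v) \<times> ?S (snd v)"
      by (cases p) (simp add: torus_V_def, blast)
  qed
  moreover have "fst v < L" "snd v < L" using assms by (auto simp: torus_V_def)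
  ultimately show ?thesis
    using assms(2) by (simp only: card_cartesian_product card_mod_shift power2_eq_square)
qed

section \<open>Adjacency and incidence counts\<close>

lemma inj_rt: "0 < L \<Longrightarrow> inj_on (rt L) (torus_V L)"
  by (rule inj_onI) (auto simp: rt_def torus_V_def dest: mod_shift_inj[of _ L _ 1, simplified])

lemma inj_up: "0 < L \<Longrightarrow> inj_on (up L) (torus_V L)"
  by (rule inj_onI) (auto simp: up_def torus_V_def dest: mod_shift_inj[of _ L _ 1, simplified])

lemma torus_adj_iff:
  "torus_adj L u v \<longleftrightarrow> u \<in> torus_V L \<and> v \<in> torus_V L \<and>
     (u = rt L v \<or> v = rt L u \<or> u = up L v \<or> v = up L u)"
  by (auto simp: torus_adj_def rt_def up_def prod_eq_iff)

lemma torus_adj_sym: "torus_adj L u v \<longleftrightarrow> torus_adj L v u"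
  by (auto simp: torus_adj_iff)

lemma torus_adj_irrefl:
  assumes "2 \<le> L"
  shows "\<not> torus_adj L u u"
proof
  assume "torus_adj L u u"
  then have "fst u < L" "snd u < L" "fst u = (fst u + 1) mod L \<or> snd u = (snd u + 1) mod L"
    by (auto simp: torus_adj_def torus_V_def)
  moreover have "x \<noteq> (x + 1) mod L" if "x < L" for x
    using that assms by (cases "x + 1 = L") auto
  ultimately show False by blast
qed

lemma torus_E_cases:
  assumes "e \<in> torus_E L"
  obtains u where "u \<in> torus_V L" "e = {u, rt L u} \<or> e = {u, up L u}"
  using assms by (auto simp: torus_E_def torus_adj_iff insert_commute)

lemma card_subset_Un_le:
  assumes "S \<subseteq> A \<union> B" "finite A" "finite B" "card A \<le> m" "card B \<le> n"
  shows "card S \<le> m + n"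
proof -
  have "card S \<le> card (A \<union> B)" using assms by (intro card_mono) auto
  also have "\<dots> \<le> card A + card B" by (rule card_Un_le)
  finally show ?thesis using assms(4,5) by linarith
qed

lemma torus_E_subset:
  "torus_E L \<subseteq> (\<lambda>u. {u, rt L u}) ` torus_V L \<union> (\<lambda>u. {u, up L u}) ` torus_V L"
  by (auto elim!: torus_E_cases)

lemma finite_torus_E [simp]: "finite (torus_E L)"
  by (rule finite_subset[OF torus_E_subset]) simp

lemma card_torus_E_le: "card (torus_E L) \<le> 2 * L\<^sup>2"
proof -
  have "card (torus_E L) \<le> card (torus_V L) + card (torus_V L)"
    by (rule card_subset_Un_le[OF torus_E_subset]) (simp_all add: card_image_le)
  then show ?thesis by (simp add: card_torus_V)
qed

lemma card_inj_preimage_le: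
  assumes "inj_on R V" "finite S"
  shows "card {u \<in> V. R u \<in> S} \<le> card S"
  using assms by (intro card_inj_on_le[of R]) (auto intro: inj_on_subset)

lemma card_edges_touching_le:
  assumes "0 < L" "finite S"
  shows "card {e \<in> torus_E L. e \<inter> S \<noteq> {}} \<le> 4 * card S"
proof -
  let ?H = "\<lambda>R. S \<union> {u \<in> torus_V L. R u \<in> S}"
  have H: "card ((\<lambda>u. {u, R u}) ` ?H R) \<le> card S + card S" if "inj_on R (torus_V L)" for R
  proof (rule order_trans[OF card_image_le])
    show "card (?H R) \<le> card S + card S"
      by (rule card_subset_Un_le[OF order_refl]) (simp_all add: assms card_inj_preimage_le that)
  qed (simp add: assms)
  have "card {e \<in> torus_E L. e \<inter> S \<noteq> {}} \<le> (card S + card S) + (card S + card S)"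
  proof (rule card_subset_Un_le[OF _ _ _ H H])
    show "{e \<in> torus_E L. e \<inter> S \<noteq> {}}
      \<subseteq> (\<lambda>u. {u, rt L u}) ` ?H (rt L) \<union> (\<lambda>u. {u, up L u}) ` ?H (up L)"
      by (auto elim!: torus_E_cases)
  qed (simp_all add: assms inj_rt inj_up)
  then show ?thesis by simp
qed

lemma card_nbrs_le:
  assumes "0 < L"
  shows "card {u. torus_adj L v u} \<le> 4"
proof -
  let ?P = "\<lambda>R. {u \<in> torus_V L. R u \<in> {v}}"
  have P: "card (?P (rt L)) \<le> 1" "card (?P (up L)) \<le> 1"
    using card_inj_preimage_le[OF inj_rt[OF assms], of "{v}"]
      card_inj_preimage_le[OF inj_up[OF assms], of "{v}"] by simp_all
  have U: "card (?P (rt L) \<union> ?P (up L)) \<le> 1 + 1"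
    by (rule card_subset_Un_le[OF order_refl _ _ P]) simp_all
  have T: "card {rt L v, up L v} \<le> 2" by (simp add: card_insert_if)
  have "card {u. torus_adj L v u} \<le> 2 + (1 + 1)"
    by (rule card_subset_Un_le[OF _ _ _ T U]) (auto simp: torus_adj_iff)
  then show ?thesis by simp
qed

lemma card_adjacent_blocks_le:
  assumes "0 < L" "r \<le> L"
  shows "card {p \<in> torus_V L. \<exists>u\<in>block L r p. torus_adj L v u} \<le> 4 * r\<^sup>2"
proof -
  let ?N = "{u. torus_adj L v u}"
  have fin: "finite ?N" by (rule finite_subset[of _ "torus_V L"]) (auto simp: torus_adj_iff)
  have "card {p \<in> torus_V L. \<exists>u\<in>block L r p. torus_adj L v u}
      \<le> card (\<Union>u\<in>?N. {p \<in> torus_V L. u \<in> block L r p})"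
    using fin by (intro card_mono) auto
  also have "\<dots> \<le> (\<Sum>u\<in>?N. card {p \<in> torus_V L. u \<in> block L r p})"
    by (rule card_UN_le[OF fin])
  also have "\<dots> = card ?N * r\<^sup>2"
    using assms by (simp add: card_blocks_containing torus_adj_iff)
  also have "\<dots> \<le> 4 * r\<^sup>2"
    using card_nbrs_le[OF assms(1)] by (rule mult_right_mono) simp
  finally show ?thesis .
qed

text \<open>The edges \<open>{u, R u}\<close> of one direction are indexed by \<open>u\<close>;
  those counted meet \<open>S\<close> and have no end in \<open>B - S\<close>. Such an edge is
  charged to \<open>u\<close> if \<open>u\<close> lies in \<open>S\<close>. Otherwise it enters
  \<open>B\<close> at the first site of a line that starts in \<open>S\<close>. Unless the line is
  wholly in \<open>S\<close>, it leaves \<open>S\<close> at an element of \<open>cut\<close>, which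
  carries no charge of its own. So the excess over \<open>card S\<close> is at most the number of
  full lines, and each of these uses up \<open>r\<close> elements of \<open>S\<close>.\<close>

lemma row_edge_count:
  fixes R :: "'v \<Rightarrow> 'v" and e :: "nat \<Rightarrow> 'j \<Rightarrow> 'v"
  assumes V: "finite V" "inj_on R V" and J: "finite J"
    and B: "B = (\<lambda>(k, j). e k j) ` ({..<r} \<times> J)" "B \<subseteq> V"
    and inj: "inj_on (\<lambda>(k, j). e k j) ({..<r} \<times> J)"
    and step: "\<And>k j. j \<in> J \<Longrightarrow> R (e k j) = e (Suc k) j"
    and S: "S \<subseteq> B"
  shows "r * card {u \<in> V. (u \<in> S \<or> R u \<in> S) \<and> (u \<in> S \<or> u \<notin> B) \<and> (R u \<in> S \<or> R u \<notin> B)}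
    \<le> (r + 1) * card S"
proof (cases "r = 0")
  case False
  let ?H = "{u \<in> V. (u \<in> S \<or> R u \<in> S) \<and> (u \<in> S \<or> u \<notin> B) \<and> (R u \<in> S \<or> R u \<notin> B)}"
  define cut where "cut = {u \<in> S. R u \<in> B - S}"
  define J0 where "J0 = {j \<in> J. e 0 j \<in> S}"
  define F where "F = {j \<in> J. \<forall>k<r. e k j \<in> S}"
  have finS: "finite S" using S B V finite_subset by metis
  have FJ0: "F \<subseteq> J0" using False by (auto simp: F_def J0_def)
  have fins: "finite J0" "finite F" "finite cut"
    using J finS by (auto simp: J0_def F_def cut_def)
  have "?H \<subseteq> (S - cut) \<union> {u \<in> V. R u \<in> e 0 ` J0}"
  proof
    fix u assume u: "u \<in> ?H"
    show "u \<in> (S - cut) \<union> {u \<in> V. R u \<in> e 0 ` J0}"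
    proof (cases "u \<in> S")
      case True
      then show ?thesis using u by (auto simp: cut_def)
    next
      case nS: False
      then have "u \<notin> B" "R u \<in> S" "u \<in> V" using u by auto
      then obtain k j where kj: "k < r" "j \<in> J" "R u = e k j" using S B by auto
      \<comment> \<open>A later site of the line has its predecessor in \<open>B\<close>, and
        injectivity of \<open>R\<close> would make that predecessor equal to
        \<open>u\<close>.\<close>
      have "k = 0"
      proof (cases k)
        case (Suc k')
        then have "e k' j \<in> B" using kj B by auto
        moreover have "R u = R (e k' j)" using kj Suc step by simp
        ultimately have "u = e k' j" using V(2) \<open>u \<in> V\<close> B(2) by (auto dest: inj_onD)
        then show ?thesis using \<open>u \<notin> B\<close> \<open>e k' j \<in> B\<close> by simp
      qed simp
      then show ?thesis using kj \<open>R u \<in> S\<close> \<open>u \<in> V\<close> by (auto simp: J0_def)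
    qed
  qed
  then have "card ?H \<le> card (S - cut) + card {u \<in> V. R u \<in> e 0 ` J0}"
    by (rule card_subset_Un_le) (simp_all add: finS V)
  also have "card {u \<in> V. R u \<in> e 0 ` J0} \<le> card (e 0 ` J0)"
    using fins by (intro card_inj_preimage_le V) auto
  also have "\<dots> \<le> card J0" using fins by (intro card_image_le)
  also have "card (S - cut) = card S - card cut"
    using fins by (intro card_Diff_subset) (auto simp: cut_def)
  finally have H: "card ?H \<le> (card S - card cut) + card J0" by simp
  have cutS: "card cut \<le> card S" using finS by (intro card_mono) (auto simp: cut_def)
  have J0F: "card (J0 - F) \<le> card cut"
  proof -
    \<comment> \<open>First exit from \<open>S\<close> along the line \<open>j\<close>; it is
      positive because the line starts in \<open>S\<close>, and the site before it lies in
      \<open>cut\<close>.\<close>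
    define k where "k j = (LEAST k. e k j \<notin> S)" for j
    have k: "0 < k j" "k j < r" "e (k j) j \<notin> S" "e (k j - 1) j \<in> S" if j: "j \<in> J0 - F" for j
    proof -
      obtain k' where k': "k' < r" "e k' j \<notin> S" using j by (auto simp: F_def J0_def)
      show 1: "e (k j) j \<notin> S" unfolding k_def by (rule LeastI[of "\<lambda>k. e k j \<notin> S", OF k'(2)])
      show "k j < r" unfolding k_def using Least_le[of "\<lambda>k. e k j \<notin> S", OF k'(2)] k'(1) by simp
      show 0: "0 < k j" using 1 j by (cases "k j") (auto simp: J0_def)
      show "e (k j - 1) j \<in> S"
        using not_less_Least[of "k j - 1" "\<lambda>k. e k j \<notin> S"] 0 unfolding k_def by auto
    qed
    have "inj_on (\<lambda>j. e (k j - 1) j) (J0 - F)"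
    proof (rule inj_onI)
      fix i j assume ij: "i \<in> J0 - F" "j \<in> J0 - F" and eq: "e (k i - 1) i = e (k j - 1) j"
      have "(k i - 1, i) = (k j - 1, j)"
        using ij k[OF ij(1)] k[OF ij(2)] eq
        by (intro inj_onD[OF inj]) (auto simp: J0_def)
      then show "i = j" by simp
    qed
    moreover have "(\<lambda>j. e (k j - 1) j) ` (J0 - F) \<subseteq> cut"
    proof safe
      fix j assume j: "j \<in> J0" "j \<notin> F"
      then have kj: "0 < k j" "k j < r" "e (k j) j \<notin> S" "e (k j - 1) j \<in> S" using k by auto
      have "R (e (k j - 1) j) = e (k j) j" using step[of j "k j - 1"] j kj by (simp add: J0_def)
      moreover have "e (k j) j \<in> B" using kj j B by (auto simp: J0_def)
      ultimately show "e (k j - 1) j \<in> cut" using kj by (simp add: cut_def)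
    qed
    ultimately show ?thesis using fins by (intro card_inj_on_le)
  qed
  have "card J0 = card (J0 - F) + card F"
    using FJ0 fins by (simp add: card_Diff_subset card_mono)
  then have "card ?H \<le> card S + card F" using H J0F cutS by linarith
  moreover have "r * card F \<le> card S"
  proof -
    have "card ((\<lambda>(k, j). e k j) ` ({..<r} \<times> F)) = r * card F"
      using inj by (subst card_image) (auto simp: card_cartesian_product F_def elim!: inj_on_subset)
    moreover have "(\<lambda>(k, j). e k j) ` ({..<r} \<times> F) \<subseteq> S" by (auto simp: F_def)
    ultimately show ?thesis using finS card_mono by metis
  qed
  ultimately have "r * card ?H \<le> r * card S + card S"
    by (meson add_left_mono le_trans mult_le_mono2 add_mult_distrib2[THEN eq_refl])
  then show ?thesis by simp
qed simp

text \<open>\<open>S\<close> is a whole colour class of the block, so a monochromatic edge meeting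
  it has each end in \<open>S\<close> or outside the block. After multiplication by
  \<open>r\<close>, each of the two directions contributes at most \<open>(r + 1) * card S\<close>,
  the vertical one by transposing the roles of rows and columns.\<close>

lemma block_edge_count:
  assumes p: "p \<in> torus_V L" and r: "r \<le> L" and S: "S \<subseteq> block L r p"
    and c: "\<And>u. u \<in> block L r p \<Longrightarrow> \<sigma> u = c \<longleftrightarrow> u \<in> S"
  shows "r * card {e \<in> torus_E L. (\<exists>c. \<forall>u\<in>e. \<sigma> u = c) \<and> e \<inter> S \<noteq> {}} \<le> (2 * r + 2) * card S"
proof -
  let ?B = "block L r p" and ?V = "torus_V L"
  let ?H = "\<lambda>R. {u \<in> ?V. (u \<in> S \<or> R u \<in> S) \<and> (u \<in> S \<or> u \<notin> ?B) \<and> (R u \<in> S \<or> R u \<notin> ?B)}"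
  have L: "0 < L" using p by (auto simp: torus_V_def)
  have k_inj: "k = k'" if "(a + k) mod L = (a + k') mod L" "k < r" "k' < r" "a < L" for a k k'
    using mod_shift_inj[of k L k' a] that r by (metis add.commute less_imp_le order.strict_trans2)
  have pL: "fst p < L" "snd p < L" using p by (auto simp: torus_V_def)
  let ?e = "\<lambda>k j. ((fst p + k) mod L, (snd p + j) mod L)"
  have inj: "inj_on (\<lambda>(k, j). ?e k j) ({..<r} \<times> {..<r})"
  proof (rule inj_onI)
    fix x y assume xy: "x \<in> {..<r} \<times> {..<r}" "y \<in> {..<r} \<times> {..<r}"
      and eq: "(\<lambda>(k, j). ?e k j) x = (\<lambda>(k, j). ?e k j) y"
    then have "fst x = fst y" "snd x = snd y"
      using k_inj[of "fst p" "fst x" "fst y"] k_inj[of "snd p" "snd x" "snd y"] pL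
      unfolding case_prod_unfold mem_Times_iff lessThan_iff by blast+
    then show "x = y" by (rule prod_eqI)
  qed
  have swap: "(\<lambda>(k, j). ?e j k) = (\<lambda>(k, j). ?e k j) \<circ> prod.swap" by auto
  have swap_sq: "prod.swap ` ({..<r} \<times> {..<r}) = {..<r} \<times> {..<r}" by auto
  have HR: "r * card (?H (rt L)) \<le> (r + 1) * card S"
  proof (rule row_edge_count[where J = "{..<r}" and e = ?e])
    show "rt L (?e k j) = ?e (Suc k) j" for k j
      by (simp add: rt_def mod_Suc_eq)
  qed (use inj L S block_subset[OF L] inj_rt in \<open>simp_all add: block_def\<close>)
  have HU: "r * card (?H (up L)) \<le> (r + 1) * card S"
  proof (rule row_edge_count[where J = "{..<r}" and e = "\<lambda>k j. ?e j k"])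
    show "up L (?e j k) = ?e j (Suc k)" for k j
      by (simp add: up_def mod_Suc_eq)
    show "inj_on (\<lambda>(k, j). ?e j k) ({..<r} \<times> {..<r})"
      unfolding swap by (rule comp_inj_on) (simp_all only: swap_sq inj inj_swap)
    show "?B = (\<lambda>(k, j). ?e j k) ` ({..<r} \<times> {..<r})"
      unfolding swap image_comp[symmetric] swap_sq block_def ..
  qed (use L S block_subset[OF L] inj_up in simp_all)
  have "card {e \<in> torus_E L. (\<exists>c. \<forall>u\<in>e. \<sigma> u = c) \<and> e \<inter> S \<noteq> {}}
      \<le> card (?H (rt L)) + card (?H (up L))"
  proof -
    have "{e \<in> torus_E L. (\<exists>c. \<forall>u\<in>e. \<sigma> u = c) \<and> e \<inter> S \<noteq> {}}
        \<subseteq> (\<lambda>u. {u, rt L u}) ` ?H (rt L) \<union> (\<lambda>u. {u, up L u}) ` ?H (up L)"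
    proof
      fix e assume "e \<in> {e \<in> torus_E L. (\<exists>c. \<forall>u\<in>e. \<sigma> u = c) \<and> e \<inter> S \<noteq> {}}"
      then have e: "e \<in> torus_E L" "\<exists>c. \<forall>u\<in>e. \<sigma> u = c" "e \<inter> S \<noteq> {}" by auto
      from e(3) obtain s where "s \<in> e" "s \<in> S" by blast
      then have ec: "\<forall>u\<in>e. \<sigma> u = c" using e(2) c S by (metis subsetD)
      have eS: "\<forall>u\<in>e. u \<in> S \<or> u \<notin> ?B" using ec c by blast
      from e(1) obtain u where "u \<in> ?V" "e = {u, rt L u} \<or> e = {u, up L u}" by (rule torus_E_cases)
      then show "e \<in> (\<lambda>u. {u, rt L u}) ` ?H (rt L) \<union> (\<lambda>u. {u, up L u}) ` ?H (up L)"
        using eS e(3) by blast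
    qed
    then show ?thesis
      by (rule card_subset_Un_le) (simp_all add: card_image_le)
  qed
  then have "r * card {e \<in> torus_E L. (\<exists>c. \<forall>u\<in>e. \<sigma> u = c) \<and> e \<inter> S \<noteq> {}}
     \<le> r * (card (?H (rt L)) + card (?H (up L)))"
    by (rule mult_le_mono2)
  also have "\<dots> \<le> (r + 1) * card S + (r + 1) * card S"
    unfolding add_mult_distrib2 using HR HU by (rule add_mono)
  finally show ?thesis by (simp add: algebra_simps)
qed

lemma mono_edges_le_touching:
  assumes "\<And>u. u \<notin> S \<Longrightarrow> \<sigma> u = \<tau> u"
  shows "mono_edges L \<sigma> \<le> mono_edges L \<tau> + card {e \<in> torus_E L. (\<exists>c. \<forall>u\<in>e. \<sigma> u = c) \<and> e \<inter> S \<noteq> {}}"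
proof -
  let ?T = "{e \<in> torus_E L. (\<exists>c. \<forall>u\<in>e. \<sigma> u = c) \<and> e \<inter> S \<noteq> {}}"
  have "{e \<in> torus_E L. \<exists>c. \<forall>u\<in>e. \<sigma> u = c} \<subseteq> {e \<in> torus_E L. \<exists>c. \<forall>u\<in>e. \<tau> u = c} \<union> ?T"
  proof
    fix e assume e: "e \<in> {e \<in> torus_E L. \<exists>c. \<forall>u\<in>e. \<sigma> u = c}"
    show "e \<in> {e \<in> torus_E L. \<exists>c. \<forall>u\<in>e. \<tau> u = c} \<union> ?T"
    proof (cases "e \<inter> S = {}")
      case True
      then have "\<forall>u\<in>e. \<sigma> u = \<tau> u" using assms by blast
      then show ?thesis using e by auto
    qed (use e in auto)
  qed
  then show ?thesis
    unfolding mono_edges_def by (rule card_subset_Un_le) simp_all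
qed

text \<open>Edges away from \<open>v\<close> ignore the update, and the monochromatic edges at
  \<open>v\<close> correspond to its neighbours of colour \<open>c\<close>. \<open>2 \<le> L\<close>
  excludes loops; for \<open>L = 2\<close> a double adjacency counts once on both sides, since edges
  are sets and neighbours are vertices.\<close>

lemma mono_edges_upd:
  assumes v: "v \<in> torus_V L" and L: "2 \<le> L"
  shows "mono_edges L (X(v := c))
    = card {e \<in> torus_E L. v \<notin> e \<and> (\<exists>c. \<forall>u\<in>e. X u = c)} + nbr_count L X v c"
proof -
  let ?M = "{e \<in> torus_E L. \<exists>c'. \<forall>u\<in>e. (X(v := c)) u = c'}"
  let ?N = "{u \<in> torus_V L. torus_adj L v u \<and> X u = c}"
  have nv: "u \<noteq> v" if "torus_adj L v u" for u using torus_adj_irrefl[OF L] that by blast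
  have 1: "{e \<in> ?M. v \<notin> e} = {e \<in> torus_E L. v \<notin> e \<and> (\<exists>c. \<forall>u\<in>e. X u = c)}"
  proof -
    have "(\<forall>u\<in>e. (X(v := c)) u = c') \<longleftrightarrow> (\<forall>u\<in>e. X u = c')" if "v \<notin> e" for e c'
      using that by (intro ball_cong refl) auto
    then show ?thesis by blast
  qed
  have 2: "{e \<in> ?M. v \<in> e} = (\<lambda>u. {v, u}) ` ?N"
  proof (intro equalityI subsetI)
    fix e assume "e \<in> {e \<in> ?M. v \<in> e}"
    then obtain c' where e: "e \<in> torus_E L" "v \<in> e" "\<forall>u\<in>e. (X(v := c)) u = c'" by blast
    then have "c' = c" by auto
    from e obtain u where u: "e = {v, u}" "torus_adj L v u"
      unfolding torus_E_def using torus_adj_sym by (auto simp: insert_commute)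
    then have "X u = c" using e(3) nv[OF u(2)] \<open>c' = c\<close> by auto
    then show "e \<in> (\<lambda>u. {v, u}) ` ?N" using u by (auto simp: torus_adj_iff)
  next
    fix e assume "e \<in> (\<lambda>u. {v, u}) ` ?N"
    then obtain u where u: "e = {v, u}" "torus_adj L v u" "X u = c" by blast
    then have "e \<in> torus_E L" unfolding torus_E_def by blast
    moreover have "\<forall>u\<in>e. (X(v := c)) u = c" using u by simp
    ultimately show "e \<in> {e \<in> ?M. v \<in> e}" using u by blast
  qed
  have "card ?M = card ({e \<in> ?M. v \<notin> e} \<union> {e \<in> ?M. v \<in> e})"
    by (rule arg_cong[where f = card]) blast
  also have "\<dots> = card {e \<in> ?M. v \<notin> e} + card {e \<in> ?M. v \<in> e}"
    by (rule card_Un_disjoint) auto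
  also have "card {e \<in> ?M. v \<in> e} = card ?N"
    unfolding 2 using nv by (intro card_image) (auto simp: inj_on_def doubleton_eq_iff)
  finally show ?thesis unfolding mono_edges_def nbr_count_def 1 .
qed

section \<open>Block dynamics of the Potts model\<close>

locale potts =
  fixes L q :: nat and lam :: real
  assumes lam_gt: "1 < lam" and L_ge: "2 \<le> L" and q_pos: "0 < q"
begin

sublocale spin_space "torus_V L" "{..<q}"
  by unfold_locales simp_all

definition wt :: "(nat \<times> nat \<Rightarrow> nat) \<Rightarrow> real" where
  "wt X = lam ^ mono_edges L X"

lemma Om_configs: "Om = configs L q"
  by (simp add: Om_def configs_def)

lemma wt_pos: "0 < wt X"
  using lam_gt by (simp add: wt_def)

lemma positive_wt: "positive wt"
  by (simp add: positive_def wt_pos)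

lemma wt_ge_1: "1 \<le> wt X"
  using lam_gt by (simp add: wt_def)

lemma Om_nonempty: "Om \<noteq> {}"
  using q_pos by (auto simp: Om_def PiE_eq_empty_iff)

lemma torus_V_nonempty: "torus_V L \<noteq> {}"
proof -
  have "(0, 0) \<in> torus_V L" using L_ge by (simp add: torus_V_def)
  then show ?thesis by blast
qed

text \<open>As every weight is at least 1, the partition function also bounds the inverse of the
  least Gibbs probability.\<close>

lemma total_wt_le: "(\<Sum>X\<in>Om. wt X) \<le> (real q * lam\<^sup>2) ^ (L\<^sup>2)"
proof -
  have "wt X \<le> lam ^ (2 * L\<^sup>2)" for X
  proof -
    have "mono_edges L X \<le> card (torus_E L)"
      unfolding mono_edges_def by (intro card_mono) auto
    then have "mono_edges L X \<le> 2 * L\<^sup>2" using card_torus_E_le[of L] by linarith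
    then show ?thesis unfolding wt_def using lam_gt by (intro power_increasing) auto
  qed
  then have "(\<Sum>X\<in>Om. wt X) \<le> real (card Om) * lam ^ (2 * L\<^sup>2)"
    by (intro sum_bounded_above) auto
  also have "card Om = q ^ (L\<^sup>2)"
    by (simp add: Om_def card_PiE card_torus_V)
  finally show ?thesis by (simp add: power_mult_distrib power_mult)
qed

text \<open>An edge monochromatic in \<open>X\<close> but not in \<open>Y\<close> meets
  \<open>B\<close>. This supplies the factor \<open>K\<close> of the block comparison.\<close>

lemma wt_cls_ratio:
  assumes "B \<subseteq> torus_V L" "Y \<in> cls B X"
  shows "wt X \<le> lam ^ (4 * card B) * wt Y"
proof -
  have finB: "finite B" using assms finite_I finite_subset by blast
  have "mono_edges L X \<le> mono_edges L Y + card {e \<in> torus_E L. (\<exists>c. \<forall>u\<in>e. X u = c) \<and> e \<inter> B \<noteq> {}}"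
    by (rule mono_edges_le_touching) (rule cls_outside[OF assms(2), symmetric])
  also have "card {e \<in> torus_E L. (\<exists>c. \<forall>u\<in>e. X u = c) \<and> e \<inter> B \<noteq> {}}
      \<le> card {e \<in> torus_E L. e \<inter> B \<noteq> {}}"
    by (intro card_mono) auto
  also have "\<dots> \<le> 4 * card B"
    using L_ge finB by (intro card_edges_touching_le) auto
  finally have "mono_edges L X \<le> 4 * card B + mono_edges L Y" by simp
  then have "lam ^ mono_edges L X \<le> lam ^ (4 * card B + mono_edges L Y)"
    using lam_gt by (intro power_increasing) auto
  then show ?thesis by (simp add: wt_def power_add)
qed

lemma wt_monochromatic_set_le:
  assumes p: "p \<in> torus_V L" and r: "1 \<le> r" "r \<le> L"
    and S: "S = {u \<in> block L r p. \<sigma> u = c}" and \<tau>: "\<And>u. u \<notin> S \<Longrightarrow> \<tau> u = \<sigma> u"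
  shows "wt \<sigma> \<le> (lam powr (2 + 2 / real r)) ^ card S * wt \<tau>"
proof -
  let ?t = "card {e \<in> torus_E L. (\<exists>c. \<forall>u\<in>e. \<sigma> u = c) \<and> e \<inter> S \<noteq> {}}"
  have "mono_edges L \<sigma> \<le> ?t + mono_edges L \<tau>"
    using mono_edges_le_touching[of S \<sigma> \<tau> L] \<tau> by simp
  then have "wt \<sigma> \<le> lam ^ (?t + mono_edges L \<tau>)"
    unfolding wt_def using lam_gt by (intro power_increasing) auto
  also have "\<dots> = lam ^ ?t * wt \<tau>" by (simp add: wt_def power_add)
  also have "lam ^ ?t \<le> (lam powr (2 + 2 / real r)) ^ card S"
  proof -
    have "r * ?t \<le> (2 * r + 2) * card S"
      using S by (intro block_edge_count[OF p r(2)]) auto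
    then have "real r * real ?t \<le> (2 * real r + 2) * real (card S)"
      by (metis (mono_tags, lifting) of_nat_add of_nat_le_iff of_nat_mult of_nat_numeral)
    then have "real ?t \<le> (2 + 2 / real r) * real (card S)"
      using r(1) by (simp add: field_simps)
    then have "lam powr real ?t \<le> lam powr ((2 + 2 / real r) * real (card S))"
      using lam_gt by (intro powr_mono) auto
    then show ?thesis
      using lam_gt by (simp add: powr_realpow powr_powr[symmetric])
  qed
  finally show ?thesis using wt_pos[of \<tau>] by simp
qed

text \<open>The \<open>x\<close> of the overview: the weight gained per site of a colour class
  against the \<open>q\<close> choices given up.\<close>

definition weight_ratio :: "nat \<Rightarrow> real" where
  "weight_ratio r = lam powr (2 + 2 / real r) / real q"

lemma weight_ratio_pos: "0 < weight_ratio r"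
  using lam_gt q_pos by (simp add: weight_ratio_def)

text \<open>Energy against entropy. Recolouring \<open>S\<close> by an arbitrary \<open>g\<close>
  yields \<open>q ^ card S\<close> configurations of the same class, each losing at most a factor
  \<open>lam powr (2 + 2 / r)\<close> per site. \<open>\<Phi>\<close> is injective because the
  colour it erases on \<open>S\<close> is always \<open>c\<close>.\<close>

lemma colour_class_weight_le:
  assumes p: "p \<in> torus_V L" and r: "1 \<le> r" "r \<le> L" and X: "X \<in> Om"
    and S: "S \<subseteq> block L r p"
  shows "(\<Sum>\<sigma>\<in>{\<sigma> \<in> cls (block L r p) X. {u \<in> block L r p. \<sigma> u = c} = S}. wt \<sigma>)
    \<le> weight_ratio r ^ card S * (\<Sum>\<sigma>\<in>cls (block L r p) X. wt \<sigma>)"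
proof -
  let ?B = "block L r p" and ?\<Lambda> = "lam powr (2 + 2 / real r)"
  let ?D = "{\<sigma> \<in> cls ?B X. {u \<in> ?B. \<sigma> u = c} = S}"
  let ?G = "PiE S (\<lambda>_. {..<q})"
  define \<Phi> where "\<Phi> = (\<lambda>(\<sigma>, g) u. if u \<in> S then g u else (\<sigma> u :: nat))"
  have finS: "finite S" using S finite_subset finite_block by blast
  have BV: "?B \<subseteq> torus_V L" using L_ge by (intro block_subset) auto
  have cardG: "card ?G = q ^ card S" using finS by (simp add: card_PiE)
  have inj: "inj_on \<Phi> (?D \<times> ?G)"
  proof (rule inj_onI)
    fix x y assume xy: "x \<in> ?D \<times> ?G" "y \<in> ?D \<times> ?G" and eq: "\<Phi> x = \<Phi> y"
    obtain \<sigma> g \<tau> h where x: "x = (\<sigma>, g)" and y: "y = (\<tau>, h)" by (metis surj_pair)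
    have "\<sigma> u = \<tau> u" for u
    proof (cases "u \<in> S")
      case True
      then have "\<sigma> u = c" "\<tau> u = c" using xy x y by blast+
      then show ?thesis by simp
    next
      case False
      then show ?thesis using fun_cong[OF eq, of u] by (simp add: \<Phi>_def x y)
    qed
    moreover have "g u = h u" for u
    proof (cases "u \<in> S")
      case True
      then show ?thesis using fun_cong[OF eq, of u] by (simp add: \<Phi>_def x y)
    next
      case False
      moreover have "g \<in> ?G" "h \<in> ?G" using xy x y by blast+
      ultimately show ?thesis by (metis PiE_arb)
    qed
    ultimately show "x = y" by (simp add: x y fun_eq_iff)
  qed
  have img: "\<Phi> ` (?D \<times> ?G) \<subseteq> cls ?B X"
  proof (rule image_subsetI)
    fix x assume x: "x \<in> ?D \<times> ?G"
    obtain \<sigma> g where xs: "x = (\<sigma>, g)" by (cases x)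
    have "\<sigma> \<in> cls ?B X" "g \<in> ?G" using x xs by blast+
    then have \<sigma>: "\<sigma> \<in> Om" "\<And>u. u \<notin> ?B \<Longrightarrow> \<sigma> u = X u" and g: "\<And>u. u \<in> S \<Longrightarrow> g u < q"
      using cls_subset cls_outside by auto
    have "\<Phi> x \<in> Om"
      using \<sigma>(1) g S BV by (auto simp: Om_def PiE_def Pi_def extensional_def \<Phi>_def xs)
    moreover have "\<Phi> x u = X u" if "u \<notin> ?B" for u
    proof -
      have "u \<notin> S" using that S by blast
      then show ?thesis using \<sigma>(2)[OF that] by (simp add: \<Phi>_def xs)
    qed
    ultimately show "\<Phi> x \<in> cls ?B X" by (rule clsI)
  qed
  have "(\<Sum>\<sigma>\<in>?D. wt \<sigma>) * real q ^ card S = (\<Sum>\<sigma>\<in>?D. \<Sum>g\<in>?G. wt \<sigma>)"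
    by (simp add: cardG sum_distrib_left mult.commute)
  also have "\<dots> = (\<Sum>x\<in>?D \<times> ?G. wt (fst x))"
    unfolding sum.cartesian_product case_prod_unfold ..
  also have "\<dots> \<le> (\<Sum>x\<in>?D \<times> ?G. ?\<Lambda> ^ card S * wt (\<Phi> x))"
  proof (rule sum_mono)
    fix x assume x: "x \<in> ?D \<times> ?G"
    obtain \<sigma> g where xs: "x = (\<sigma>, g)" by (cases x)
    have "S = {u \<in> ?B. \<sigma> u = c}" using x xs by blast
    then have "wt \<sigma> \<le> ?\<Lambda> ^ card S * wt (\<Phi> x)"
      by (rule wt_monochromatic_set_le[OF p r]) (simp add: \<Phi>_def xs)
    then show "wt (fst x) \<le> ?\<Lambda> ^ card S * wt (\<Phi> x)" by (simp add: xs)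
  qed
  also have "\<dots> = ?\<Lambda> ^ card S * (\<Sum>\<sigma>\<in>\<Phi> ` (?D \<times> ?G). wt \<sigma>)"
    by (simp add: sum.reindex[OF inj] flip: sum_distrib_left)
  also have "\<dots> \<le> ?\<Lambda> ^ card S * (\<Sum>\<sigma>\<in>cls ?B X. wt \<sigma>)"
    using img wt_pos by (intro mult_left_mono sum_mono2) (auto intro: less_imp_le)
  finally show ?thesis
    using q_pos by (simp add: weight_ratio_def power_divide field_simps)
qed

text \<open>Sum over the nonempty sets \<open>S\<close> that the colour may occupy, at most
  \<open>2 ^ (r^2)\<close> of them; since the ratio is at most 1, its first power bounds every
  term.\<close>

lemma colour_present_weight_le:
  assumes p: "p \<in> torus_V L" and r: "1 \<le> r" "r \<le> L" and X: "X \<in> Om"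
    and x1: "weight_ratio r \<le> 1"
  shows "(\<Sum>\<sigma>\<in>{\<sigma> \<in> cls (block L r p) X. \<exists>u\<in>block L r p. \<sigma> u = c}. wt \<sigma>)
    \<le> 2 ^ (r\<^sup>2) * weight_ratio r * (\<Sum>\<sigma>\<in>cls (block L r p) X. wt \<sigma>)"
proof -
  let ?B = "block L r p" and ?x = "weight_ratio r"
  let ?D = "\<lambda>S. {\<sigma> \<in> cls ?B X. {u \<in> ?B. \<sigma> u = c} = S}"
  let ?Z = "\<Sum>\<sigma>\<in>cls ?B X. wt \<sigma>"
  have Z: "0 \<le> ?Z" by (intro sum_nonneg) (simp add: wt_pos less_imp_le)
  have fin: "finite (Pow ?B - {{}})" by simp
  have "{\<sigma> \<in> cls ?B X. \<exists>u\<in>?B. \<sigma> u = c} \<subseteq> (\<Union>S\<in>Pow ?B - {{}}. ?D S)"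
  proof
    fix \<sigma> assume \<sigma>: "\<sigma> \<in> {\<sigma> \<in> cls ?B X. \<exists>u\<in>?B. \<sigma> u = c}"
    show "\<sigma> \<in> (\<Union>S\<in>Pow ?B - {{}}. ?D S)"
      by (rule UN_I[of "{u \<in> ?B. \<sigma> u = c}"]) (use \<sigma> in blast)+
  qed
  then have "(\<Sum>\<sigma>\<in>{\<sigma> \<in> cls ?B X. \<exists>u\<in>?B. \<sigma> u = c}. wt \<sigma>)
      \<le> (\<Sum>\<sigma>\<in>(\<Union>S\<in>Pow ?B - {{}}. ?D S). wt \<sigma>)"
    by (intro sum_mono2) (simp_all add: wt_pos less_imp_le)
  also have "\<dots> = (\<Sum>S\<in>Pow ?B - {{}}. \<Sum>\<sigma>\<in>?D S. wt \<sigma>)"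
  proof (rule sum.UNION_disjoint[OF fin])
    show "\<forall>S\<in>Pow ?B - {{}}. finite (?D S)" by simp
    show "\<forall>S\<in>Pow ?B - {{}}. \<forall>T\<in>Pow ?B - {{}}. S \<noteq> T \<longrightarrow> ?D S \<inter> ?D T = {}" by blast
  qed
  also have "\<dots> \<le> (\<Sum>S\<in>Pow ?B - {{}}. ?x * ?Z)"
  proof (rule sum_mono)
    fix S assume S: "S \<in> Pow ?B - {{}}"
    then have "S \<subseteq> ?B" "finite S" "S \<noteq> {}" using finite_subset finite_block by blast+
    then have "0 < card S" by (simp add: card_gt_0_iff)
    have "(\<Sum>\<sigma>\<in>?D S. wt \<sigma>) \<le> ?x ^ card S * ?Z"
      by (rule colour_class_weight_le[OF p r X \<open>S \<subseteq> ?B\<close>])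
    also have "?x ^ card S \<le> ?x ^ 1"
      using \<open>0 < card S\<close> x1 weight_ratio_pos[of r] by (intro power_decreasing) auto
    finally show "(\<Sum>\<sigma>\<in>?D S. wt \<sigma>) \<le> ?x * ?Z" using Z by (simp add: mult_right_mono)
  qed
  also have "\<dots> = real (card (Pow ?B - {{}})) * (?x * ?Z)" by simp
  also have "\<dots> \<le> 2 ^ (r\<^sup>2) * (?x * ?Z)"
  proof (rule mult_right_mono)
    have "card (Pow ?B - {{}}) \<le> card (Pow ?B)" by (intro card_mono) auto
    also have "\<dots> = 2 ^ card ?B" by (simp add: card_Pow)
    also have "\<dots> \<le> 2 ^ (r\<^sup>2)" using card_block_le by (intro power_increasing) auto
    finally have "real (card (Pow ?B - {{}})) \<le> real (2 ^ (r\<^sup>2))" by (rule of_nat_mono)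
    then show "real (card (Pow ?B - {{}})) \<le> 2 ^ (r\<^sup>2)" by simp
    show "0 \<le> ?x * ?Z" using Z weight_ratio_pos[of r] by simp
  qed
  finally show ?thesis by (simp add: mult.assoc)
qed

lemma wt_upd:
  assumes "v \<in> torus_V L"
  shows "wt (X(v := c)) = lam ^ card {e \<in> torus_E L. v \<notin> e \<and> (\<exists>c. \<forall>u\<in>e. X u = c)} * lam ^ nbr_count L X v c"
  unfolding wt_def mono_edges_upd[OF assms L_ge] power_add ..

text \<open>Bad configurations show one of the colours \<open>X v\<close>, \<open>Y v\<close> on a
  block site next to \<open>v\<close>. Otherwise a change at \<open>v\<close> multiplies the weight
  by a factor read off from the neighbours outside the block, common to the whole class. The two
  colours double the bound in \<open>\<delta>\<close>.\<close>

lemma cexp_block_boundary: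
  assumes p: "p \<in> torus_V L" and r: "1 \<le> r" "r \<le> L" and x1: "weight_ratio r \<le> 1"
    and v: "v \<in> torus_V L" and X: "X \<in> Om" and Y: "Y \<in> cls {v} X" and vB: "v \<notin> block L r p"
    and f: "lip f l" and l: "0 \<le> l"
    and \<delta>: "\<delta> = (if \<exists>u\<in>block L r p. torus_adj L v u then 2 ^ (r\<^sup>2 + 1) * weight_ratio r else 0)"
  shows "\<bar>cexp wt (block L r p) f X - cexp wt (block L r p) f Y\<bar> \<le> l * (1 + 3 * \<delta> * real (r\<^sup>2))"
proof -
  let ?B = "block L r p" and ?C = "{X v, Y v}"
  define Bad where "Bad = {s \<in> cls ?B X. \<exists>u\<in>?B. torus_adj L v u \<and> s u \<in> ?C}"
  have BV: "?B \<subseteq> torus_V L" using L_ge by (intro block_subset) auto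
  have YO: "Y \<in> Om" using Y cls_subset by blast
  have \<delta>0: "0 \<le> \<delta>" using \<delta> weight_ratio_pos[of r] by simp
  \<comment> \<open>Stated for any boundary \<open>W\<close>, because the bad set is weighed under
    \<open>X\<close> and, after overwriting \<open>v\<close>, under \<open>Y\<close>.\<close>
  have bad: "(\<Sum>s\<in>T. wt s) \<le> \<delta> * (\<Sum>s\<in>cls ?B W. wt s)"
    if W: "W \<in> Om" and T: "T \<subseteq> {s \<in> cls ?B W. \<exists>u\<in>?B. torus_adj L v u \<and> s u \<in> ?C}" for W T
  proof (cases "\<exists>u\<in>?B. torus_adj L v u")
    case True
    let ?D = "\<lambda>c. {s \<in> cls ?B W. \<exists>u\<in>?B. s u = c}"
    have nn: "0 \<le> wt s" for s by (simp add: wt_pos less_imp_le)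
    have "(\<Sum>s\<in>T. wt s) \<le> (\<Sum>s\<in>?D (X v) \<union> ?D (Y v). wt s)"
      using T nn by (intro sum_mono2) auto
    also have "\<dots> \<le> (\<Sum>s\<in>?D (X v). wt s) + (\<Sum>s\<in>?D (Y v). wt s)"
    proof -
      have "0 \<le> (\<Sum>s\<in>?D (X v) \<inter> ?D (Y v). wt s)" using nn by (rule sum_nonneg)
      then show ?thesis by (simp add: sum_Un)
    qed
    also have "\<dots> \<le> 2 * (2 ^ (r\<^sup>2) * weight_ratio r * (\<Sum>s\<in>cls ?B W. wt s))"
      using colour_present_weight_le[OF p r W x1, of "X v"] colour_present_weight_le[OF p r W x1, of "Y v"]
      by linarith
    finally show ?thesis using True \<delta> by (simp add: mult_ac)
  next
    case False
    then have "T = {}" using T by blast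
    then show ?thesis using \<delta>0 by (simp add: sum_nonneg wt_pos less_imp_le)
  qed
  define N where "N c = card {u \<in> torus_V L. torus_adj L v u \<and> u \<notin> ?B \<and> X u = c}" for c
  have "\<bar>cexp wt ?B f X - cexp wt ?B f Y\<bar> \<le> l * (1 + 3 * \<delta> * real (card ?B))"
  proof (rule cexp_boundary_change[OF positive_wt v X Y BV vB f l,
        where Bad = Bad and a = "lam ^ N (Y v) / lam ^ N (X v)"])
    show "Bad \<subseteq> cls ?B X" by (auto simp: Bad_def)
    show "wt (s(v := Y v)) = lam ^ N (Y v) / lam ^ N (X v) * wt s"
      if s: "s \<in> cls ?B X" and nb: "s \<notin> Bad" for s
    proof -
      have nbr: "nbr_count L s v c = N c" if c: "c \<in> ?C" for c
      proof -
        have "(torus_adj L v u \<and> s u = c) \<longleftrightarrow> (torus_adj L v u \<and> u \<notin> ?B \<and> X u = c)" for u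
        proof (cases "u \<in> ?B")
          case True
          then have "\<not> (torus_adj L v u \<and> s u = c)" using nb s c unfolding Bad_def by blast
          then show ?thesis using True by blast
        next
          case False
          with s have "s u = X u" by (rule cls_outside)
          then show ?thesis using False by simp
        qed
        then show ?thesis by (simp only: nbr_count_def N_def)
      qed
      have sv: "s(v := X v) = s" using cls_outside[OF s vB] by (simp add: fun_upd_idem)
      let ?b = "lam ^ card {e \<in> torus_E L. v \<notin> e \<and> (\<exists>c. \<forall>u\<in>e. s u = c)}"
      have "wt s = ?b * lam ^ N (X v)" using wt_upd[OF v, of s "X v"] nbr sv by simp
      moreover have "wt (s(v := Y v)) = ?b * lam ^ N (Y v)" using wt_upd[OF v, of s "Y v"] nbr by simp
      ultimately show ?thesis using lam_gt by simp
    qed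
    show "(\<Sum>s\<in>Bad. wt s) \<le> \<delta> * (\<Sum>s\<in>cls ?B X. wt s)"
      by (rule bad[OF X]) (simp add: Bad_def)
    have injB: "inj_on (\<lambda>s. s(v := Y v)) Bad"
    proof (rule inj_onI, rule ext)
      fix s t u assume s: "s \<in> Bad" "t \<in> Bad" and eq: "s(v := Y v) = t(v := Y v)"
      show "s u = t u"
      proof (cases "u = v")
        case True
        have "s v = X v" "t v = X v" using s cls_outside[OF _ vB, of _ X] unfolding Bad_def by blast+
        then show ?thesis using True by simp
      next
        case False then show ?thesis using fun_cong[OF eq, of u] by simp
      qed
    qed
    have "(\<Sum>s\<in>Bad. wt (s(v := Y v))) = (\<Sum>s\<in>(\<lambda>s. s(v := Y v)) ` Bad. wt s)"
      by (simp add: sum.reindex[OF injB])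
    also have "\<dots> \<le> \<delta> * (\<Sum>s\<in>cls ?B Y. wt s)"
    proof (rule bad[OF YO], rule image_subsetI)
      fix s assume s: "s \<in> Bad"
      have "s(v := Y v) \<in> cls ?B (X(v := Y v))"
        using s Om_val[OF YO v] by (intro upd_in_cls v) (simp_all add: Bad_def)
      moreover have "X(v := Y v) = Y" using cls_outside[OF Y] by (intro ext) simp
      moreover obtain u where u: "u \<in> ?B" "torus_adj L v u" "s u \<in> ?C" using s unfolding Bad_def by blast
      moreover have "(s(v := Y v)) u = s u" using u vB by auto
      ultimately show "s(v := Y v) \<in> {s \<in> cls ?B Y. \<exists>u\<in>?B. torus_adj L v u \<and> s u \<in> ?C}"
        by auto
    qed
    finally show "(\<Sum>s\<in>Bad. wt (s(v := Y v))) \<le> \<delta> * (\<Sum>s\<in>cls ?B Y. wt s)" .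
  qed
  also have "\<dots> \<le> l * (1 + 3 * \<delta> * real (r\<^sup>2))"
    using l \<delta>0 card_block_le[of L r p] by (intro mult_left_mono add_left_mono) (auto simp del: of_nat_power)
  finally show ?thesis .
qed

text \<open>Origin of 24: a site lies in \<open>r^2\<close> blocks, which forget it, and borders at
  most \<open>4 * r^2\<close> blocks, each adding at most \<open>3 * \<delta> * r^2\<close>. The
  hypothesis makes this loss at most half of the gain.\<close>

lemma block_contraction:
  assumes r: "1 \<le> r" "r \<le> L" and x: "24 * real (r\<^sup>2) * 2 ^ (r\<^sup>2 + 1) * weight_ratio r \<le> 1"
    and l: "0 \<le> l" and f: "lip f l"
  shows "lip (block_avg wt (torus_V L) (block L r) f) ((1 - real (r\<^sup>2) / (2 * real (L\<^sup>2))) * l)"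
proof -
  let ?V = "torus_V L" and ?d = "real (r\<^sup>2)" and ?n = "real (L\<^sup>2)"
  define \<delta> where "\<delta> = 2 ^ (r\<^sup>2 + 1) * weight_ratio r"
  have \<delta>0: "0 \<le> \<delta>" using weight_ratio_pos[of r] by (simp add: \<delta>_def)
  have d1: "1 \<le> ?d" using r by simp
  have xd: "24 * ?d * \<delta> \<le> 1" using x by (simp add: \<delta>_def mult_ac)
  have x1: "weight_ratio r \<le> 1"
  proof -
    have "1 * weight_ratio r \<le> (24 * ?d * 2 ^ (r\<^sup>2 + 1)) * weight_ratio r"
    proof (rule mult_right_mono)
      have "1 * 1 \<le> (24 * ?d) * 2 ^ (r\<^sup>2 + 1)"
        using d1 one_le_power[of "2 :: real" "r\<^sup>2 + 1"] by (intro mult_mono) linarith+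
      then show "1 \<le> 24 * ?d * 2 ^ (r\<^sup>2 + 1)" by simp
    qed (use weight_ratio_pos[of r] in simp)
    then show ?thesis using x by simp
  qed
  define c where "c v p = (if v \<in> block L r p then 0 else 1)
    + (if \<exists>u\<in>block L r p. torus_adj L v u then 3 * \<delta> * ?d else 0)" for v p
  show ?thesis
  proof (rule block_avg_lip[where c = c])
    show "finite ?V" by simp
    show "?V \<noteq> {}" by (rule torus_V_nonempty)
    show "0 \<le> l" by (rule l)
    show "\<bar>cexp wt (block L r p) f X - cexp wt (block L r p) f Y\<bar> \<le> l * c v p"
      if v: "v \<in> ?V" and X: "X \<in> Om" and Y: "Y \<in> cls {v} X" and p: "p \<in> ?V" for v X Y p
    proof (cases "v \<in> block L r p")
      case True
      then have "cexp wt (block L r p) f Y = cexp wt (block L r p) f X"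
        using Y by (rule cexp_same_class)
      moreover have "0 \<le> l * c v p" using l \<delta>0 by (simp add: c_def)
      ultimately show ?thesis by simp
    next
      case False
      have "l * (1 + 3 * (if \<exists>u\<in>block L r p. torus_adj L v u then \<delta> else 0) * ?d) = l * c v p"
        using False by (simp add: c_def)
      then show ?thesis
        using cexp_block_boundary[OF p r x1 v X Y False f l refl] unfolding \<delta>_def[symmetric] by argo
    qed
    show "(\<Sum>p\<in>?V. c v p) \<le> (1 - ?d / (2 * ?n)) * real (card ?V)" if v: "v \<in> ?V" for v
    proof -
      have n: "0 < ?n" using L_ge by simp
      let ?Adj = "{p \<in> ?V. \<exists>u\<in>block L r p. torus_adj L v u}"
      have "(\<Sum>p\<in>?V. if v \<in> block L r p then 0 else 1 :: real)
          = (\<Sum>p\<in>?V. 1 - (if v \<in> block L r p then 1 else 0))"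
        by (intro sum.cong) auto
      also have "\<dots> = ?n - real (card {p \<in> ?V. v \<in> block L r p})"
        by (simp add: sum_subtractf card_torus_V flip: sum.inter_filter)
      also have "\<dots> = ?n - ?d" using card_blocks_containing[OF v r(2)] by simp
      finally have s1: "(\<Sum>p\<in>?V. if v \<in> block L r p then 0 else 1) = ?n - ?d" .
      have "(\<Sum>p\<in>?V. if \<exists>u\<in>block L r p. torus_adj L v u then 3 * \<delta> * ?d else 0)
          = real (card ?Adj) * (3 * \<delta> * ?d)"
        by (simp flip: sum.inter_filter)
      also have "\<dots> \<le> (4 * ?d) * (3 * \<delta> * ?d)"
      proof (rule mult_right_mono)
        have "real (card ?Adj) \<le> real (4 * r\<^sup>2)"
          using card_adjacent_blocks_le[of L r v] L_ge r by (intro of_nat_mono) auto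
        then show "real (card ?Adj) \<le> 4 * ?d" by simp
      qed (use \<delta>0 in simp)
      also have "\<dots> = (24 * ?d * \<delta>) * (?d / 2)" by simp
      also have "\<dots> \<le> 1 * (?d / 2)" using xd by (rule mult_right_mono) simp
      finally have s2: "(\<Sum>p\<in>?V. if \<exists>u\<in>block L r p. torus_adj L v u then 3 * \<delta> * ?d else 0) \<le> ?d / 2"
        by simp
      have "(\<Sum>p\<in>?V. c v p) \<le> ?n - ?d / 2"
        unfolding c_def sum.distrib s1 using s2 by linarith
      also have "\<dots> = (1 - ?d / (2 * ?n)) * real (card ?V)"
        using n by (simp add: card_torus_V left_diff_distrib)
      finally show ?thesis .
    qed
  qed
qed

end

section \<open>Glauber dynamics\<close>

text \<open>The left side is the time scale of the comparison argument with room for rounding. The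
  constant 64 is 4 times 16, and \<open>4 ^ (r^2 + 1)\<close> is at least 16.\<close>

lemma bound_dominates:
  fixes n lam M :: real and r :: nat
  assumes lam: "1 < lam" and r: "1 \<le> r" and n: "1 \<le> n" and M: "0 \<le> M"
  shows "64 * (lam ^ (4 * r\<^sup>2) * n * M)
    \<le> 4 * (4 * lam ^ 8) ^ (r\<^sup>2 + 1) * n\<^sup>2 * ln (2 * exp 1 * n) * M"
proof -
  have r2: "1 \<le> r\<^sup>2" using r by simp
  have "(16 :: real) = 4 ^ 2" by simp
  also have "(4 :: real) ^ 2 \<le> 4 ^ (r\<^sup>2 + 1)" using r2 by (intro power_increasing) auto
  finally have a: "(16 :: real) \<le> 4 ^ (r\<^sup>2 + 1)" .
  have "lam ^ (4 * r\<^sup>2) \<le> lam ^ (8 * (r\<^sup>2 + 1))" using lam by (intro power_increasing) auto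
  then have b: "lam ^ (4 * r\<^sup>2) \<le> (lam ^ 8) ^ (r\<^sup>2 + 1)" by (simp only: power_mult)
  have "16 * lam ^ (4 * r\<^sup>2) \<le> 4 ^ (r\<^sup>2 + 1) * (lam ^ 8) ^ (r\<^sup>2 + 1)"
    using a b lam by (intro mult_mono) auto
  then have c: "16 * lam ^ (4 * r\<^sup>2) \<le> (4 * lam ^ 8) ^ (r\<^sup>2 + 1)" by (simp only: power_mult_distrib)
  have "1 = ln (exp 1 :: real)" by simp
  also have "\<dots> \<le> ln (2 * exp 1 * n)"
  proof (rule ln_mono)
    have "exp 1 * 1 \<le> (2 * exp 1) * n" using n by (intro mult_mono) auto
    then show "exp 1 \<le> 2 * exp 1 * n" by simp
  qed (use n in auto)
  finally have d: "1 \<le> ln (2 * exp 1 * n)" .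
  have e: "n \<le> n\<^sup>2" using n by (simp add: power2_eq_square)
  have "(16 * lam ^ (4 * r\<^sup>2)) * n * 1 * M \<le> (4 * lam ^ 8) ^ (r\<^sup>2 + 1) * n\<^sup>2 * ln (2 * exp 1 * n) * M"
    using c d e n lam M order_trans[OF zero_le_one d]
    by (intro mult_mono mult_nonneg_nonneg zero_le_power) (assumption | simp)+
  then show ?thesis by (simp add: mult_ac)
qed

text \<open>Fits the contraction hypothesis to the lower bound on \<open>q\<close>:
  \<open>24 * r^2 * 2 ^ (r^2 + 1)\<close> is \<open>6 * r^2\<close> times
  \<open>2 ^ (r^2 + 3)\<close>.\<close>

lemma six_square_le:
  fixes r :: nat
  assumes "1 \<le> r"
  shows "6 * r\<^sup>2 \<le> 2 ^ (8 * r)"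
proof -
  have "r \<le> 2 ^ r" by (simp add: less_imp_le)
  then have "r\<^sup>2 \<le> (2 ^ r)\<^sup>2" by (intro power_mono) auto
  moreover have "(2 :: nat) ^ 3 \<le> 2 ^ (6 * r)" using assms by (intro power_increasing) auto
  ultimately have "2 ^ 3 * r\<^sup>2 \<le> 2 ^ (6 * r) * (2 ^ r)\<^sup>2" by (intro mult_mono) auto
  also have "\<dots> = (2 :: nat) ^ (8 * r)" by (simp flip: power_mult power_add)
  finally show ?thesis by simp
qed

context potts
begin

abbreviation glauber :: "((nat \<times> nat \<Rightarrow> nat) \<Rightarrow> real) \<Rightarrow> (nat \<times> nat \<Rightarrow> nat) \<Rightarrow> real" where
  "glauber \<equiv> block_avg wt (torus_V L) (\<lambda>v. {v})"

section \<open>The Glauber kernel as an operator on functions\<close>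

lemma cexp_site:
  assumes v: "v \<in> torus_V L" and X: "X \<in> Om"
  shows "cexp wt {v} f X
    = (\<Sum>c<q. lam ^ nbr_count L X v c / (\<Sum>c'<q. lam ^ nbr_count L X v c') * f (X(v := c)))"
proof -
  let ?b = "lam ^ card {e \<in> torus_E L. v \<notin> e \<and> (\<exists>c. \<forall>u\<in>e. X u = c)}"
  let ?n = "\<lambda>c. lam ^ nbr_count L X v c"
  have b: "?b \<noteq> 0" using lam_gt by simp
  have "cexp wt {v} f X = (?b * (\<Sum>c<q. ?n c * f (X(v := c)))) / (?b * (\<Sum>c<q. ?n c))"
    unfolding cexp_singleton[OF v X] wt_upd[OF v] by (simp only: sum_distrib_left mult.assoc)
  also have "\<dots> = (\<Sum>c<q. ?n c * f (X(v := c))) / (\<Sum>c<q. ?n c)"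
    by (rule mult_divide_mult_cancel_left[OF b])
  also have "\<dots> = (\<Sum>c<q. ?n c / (\<Sum>c'<q. ?n c') * f (X(v := c)))"
    by (simp add: sum_divide_distrib)
  finally show ?thesis .
qed

lemma glauber_apply:
  assumes X: "X \<in> Om"
  shows "(\<Sum>Y\<in>configs L q. glauber_P L lam q X Y * f Y) = glauber f X"
proof -
  let ?w = "\<lambda>v c. lam ^ nbr_count L X v c / (\<Sum>c'<q. lam ^ nbr_count L X v c')"
  let ?g = "\<lambda>v c Y. (if Y = X(v := c) then ?w v c else 0) * f Y"
  let ?n = "real (card (torus_V L))"
  have "(\<Sum>Y\<in>configs L q. glauber_P L lam q X Y * f Y)
      = (\<Sum>Y\<in>Om. (1 / ?n) * (\<Sum>v\<in>torus_V L. \<Sum>c<q. ?g v c Y))"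
    by (simp add: Om_configs glauber_P_def sum_distrib_right)
  also have "\<dots> = (1 / ?n) * (\<Sum>Y\<in>Om. \<Sum>v\<in>torus_V L. \<Sum>c<q. ?g v c Y)"
    by (rule sum_distrib_left[symmetric])
  also have "(\<Sum>Y\<in>Om. \<Sum>v\<in>torus_V L. \<Sum>c<q. ?g v c Y) = (\<Sum>v\<in>torus_V L. \<Sum>Y\<in>Om. \<Sum>c<q. ?g v c Y)"
    by (rule sum.swap)
  also have "\<dots> = (\<Sum>v\<in>torus_V L. \<Sum>c<q. \<Sum>Y\<in>Om. ?g v c Y)"
    by (intro sum.cong refl sum.swap)
  also have "\<dots> = (\<Sum>v\<in>torus_V L. \<Sum>c<q. ?w v c * f (X(v := c)))"
  proof (intro sum.cong refl)
    fix v c assume v: "v \<in> torus_V L" and c: "c \<in> {..<q}"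
    have "X(v := c) \<in> Om" by (rule upd_in_Om[OF v X c])
    moreover have "?g v c Y = (if Y = X(v := c) then ?w v c * f (X(v := c)) else 0)" for Y
      by simp
    ultimately show "(\<Sum>Y\<in>Om. ?g v c Y) = ?w v c * f (X(v := c))"
      by (simp only: sum.delta finite_Om if_True)
  qed
  also have "\<dots> = (\<Sum>v\<in>torus_V L. cexp wt {v} f X)"
    by (intro sum.cong refl) (simp only: cexp_site[OF _ X])
  finally show ?thesis by (simp add: block_avg_def)
qed

lemma glauber_Pt_step:
  assumes X: "X \<in> Om"
  shows "(\<Sum>Y\<in>configs L q. glauber_Pt L lam q (Suc t) X Y * f Y)
    = (\<Sum>Z\<in>configs L q. glauber_Pt L lam q t X Z * glauber f Z)"
proof -
  have "(\<Sum>Y\<in>configs L q. glauber_Pt L lam q (Suc t) X Y * f Y)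
      = (\<Sum>Y\<in>configs L q. \<Sum>Z\<in>configs L q. glauber_Pt L lam q t X Z * (glauber_P L lam q Z Y * f Y))"
    by (simp add: sum_distrib_right mult.assoc)
  also have "\<dots> = (\<Sum>Z\<in>configs L q. \<Sum>Y\<in>configs L q. glauber_Pt L lam q t X Z * (glauber_P L lam q Z Y * f Y))"
    by (rule sum.swap)
  also have "\<dots> = (\<Sum>Z\<in>configs L q. glauber_Pt L lam q t X Z * glauber f Z)"
    by (intro sum.cong refl) (simp add: glauber_apply Om_configs flip: sum_distrib_left)
  finally show ?thesis .
qed

lemma glauber_Pt_zero:
  assumes "X \<in> Om"
  shows "(\<Sum>Y\<in>configs L q. glauber_Pt L lam q 0 X Y * f Y) = f X"
proof -
  have "glauber_Pt L lam q 0 X Y * f Y = (if X = Y then f Y else 0)" for Y by simp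
  then show ?thesis using assms finite_Om by (simp only: sum.delta' Om_configs if_True)
qed

lemma glauber_Pt_apply:
  assumes X: "X \<in> Om"
  shows "(\<Sum>Y\<in>configs L q. glauber_Pt L lam q t X Y * f Y) = (glauber ^^ t) f X"
proof (induction t arbitrary: f)
  case 0
  show ?case using glauber_Pt_zero[OF X] by simp
next
  case (Suc t)
  show ?case unfolding glauber_Pt_step[OF X] Suc by (simp add: funpow_swap1)
qed

lemma glauber_Pt_total:
  assumes X: "X \<in> Om"
  shows "(\<Sum>Y\<in>configs L q. glauber_Pt L lam q t X Y) = 1"
proof (induction t)
  case 0
  show ?case using glauber_Pt_zero[OF X, of "\<lambda>_. 1"] by simp
next
  case (Suc t)
  have "(\<Sum>Y\<in>configs L q. glauber_Pt L lam q (Suc t) X Y * 1)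
      = (\<Sum>Z\<in>configs L q. glauber_Pt L lam q t X Z * glauber (\<lambda>_. 1) Z)"
    by (rule glauber_Pt_step[OF X])
  also have "\<dots> = (\<Sum>Z\<in>configs L q. glauber_Pt L lam q t X Z)"
    by (intro sum.cong refl)
      (simp add: block_avg_one[OF positive_wt finite_torus_V torus_V_nonempty] Om_configs)
  finally show ?case using Suc by simp
qed

text \<open>The sign of \<open>P\<^sup>t(X, \<cdot>) - \<pi>\<close>, recentred, turns the total variation distance into a value of
  an iterate of the Glauber operator.\<close>

lemma tv_dist_as_iterate:
  assumes X: "X \<in> Om"
  obtains g where "centered wt g" "lip g 2" "ip wt g g \<le> (\<Sum>Y\<in>Om. wt Y)"
    "2 * tv_dist L lam q t X = (glauber ^^ t) g X"
proof -
  define W where "W = (\<Sum>Y\<in>Om. wt Y)"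
  have W: "0 < W" unfolding W_def using Om_nonempty wt_pos by (intro sum_pos) auto
  define D where "D Y = glauber_Pt L lam q t X Y - gibbs L lam q Y" for Y
  define s where "s Y = sgn (D Y)" for Y
  define m where "m = (\<Sum>Y\<in>Om. wt Y * s Y) / W"
  define g where "g Y = s Y - m" for Y
  have s1: "\<bar>s Y\<bar> \<le> 1" for Y by (simp add: s_def sgn_if)
  have mW: "(\<Sum>Y\<in>Om. wt Y * s Y) = m * W" using W by (simp add: m_def)
  have gibbs: "gibbs L lam q Y = wt Y / W" for Y
    by (simp add: gibbs_def wt_def W_def Om_configs)
  have "2 * tv_dist L lam q t X = (\<Sum>Y\<in>Om. D Y * s Y)"
    by (simp add: tv_dist_def D_def s_def Om_configs abs_sgn)
  also have "\<dots> = (\<Sum>Y\<in>Om. glauber_Pt L lam q t X Y * s Y) - (\<Sum>Y\<in>Om. gibbs L lam q Y * s Y)"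
    by (simp add: D_def left_diff_distrib sum_subtractf)
  also have "(\<Sum>Y\<in>Om. gibbs L lam q Y * s Y) = m"
    by (simp add: gibbs m_def sum_divide_distrib)
  also have "(\<Sum>Y\<in>Om. glauber_Pt L lam q t X Y * s Y) - m
      = (\<Sum>Y\<in>Om. glauber_Pt L lam q t X Y * s Y) - (\<Sum>Y\<in>Om. glauber_Pt L lam q t X Y) * m"
    using glauber_Pt_total[OF X] by (simp add: Om_configs)
  also have "\<dots> = (\<Sum>Y\<in>Om. glauber_Pt L lam q t X Y * g Y)"
    by (simp add: g_def right_diff_distrib sum_subtractf sum_distrib_right)
  also have "\<dots> = (glauber ^^ t) g X"
    using glauber_Pt_apply[OF X] by (simp add: Om_configs)
  finally have tv: "2 * tv_dist L lam q t X = (glauber ^^ t) g X" .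
  have cen: "centered wt g"
    using mW unfolding centered_def g_def right_diff_distrib sum_subtractf sum_distrib_right[symmetric] W_def
    by (simp add: mult.commute)
  have lip2: "lip g 2"
    unfolding lip_def
  proof (intro ballI)
    fix Y Z
    show "\<bar>g Y - g Z\<bar> \<le> 2" using s1[of Y] s1[of Z] unfolding g_def by linarith
  qed
  \<comment> \<open>A variance is at most the second moment, and signs have squares at most
    1.\<close>
  have "ip wt g g = (\<Sum>Y\<in>Om. wt Y * (s Y)\<^sup>2 - 2 * m * (wt Y * s Y) + m\<^sup>2 * wt Y)"
    unfolding ip_def g_def by (intro sum.cong refl) (simp add: algebra_simps power2_eq_square)
  also have "\<dots> = (\<Sum>Y\<in>Om. wt Y * (s Y)\<^sup>2) - 2 * m * (m * W) + m\<^sup>2 * W"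
    by (simp only: sum.distrib sum_subtractf sum_distrib_left[symmetric] mW W_def)
  also have "\<dots> = (\<Sum>Y\<in>Om. wt Y * (s Y)\<^sup>2) - m\<^sup>2 * W"
    by (simp add: power2_eq_square)
  also have "\<dots> \<le> (\<Sum>Y\<in>Om. wt Y * (s Y)\<^sup>2)" using W by simp
  also have "\<dots> \<le> (\<Sum>Y\<in>Om. wt Y)"
  proof (rule sum_mono)
    fix Y
    have "(s Y)\<^sup>2 \<le> 1" using s1[of Y] by (simp add: abs_square_le_1)
    then show "wt Y * (s Y)\<^sup>2 \<le> wt Y" using wt_pos[of Y] by simp
  qed
  finally show thesis using that cen lip2 tv by blast
qed

text \<open>Iterates of the centred test function keep mean 0, so their values are at most the
  number of sites times the Lipschitz constant, initially 2. No least probability enters.\<close>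

lemma tv_dist_le_of_contraction:
  assumes X: "X \<in> Om" and \<rho>: "0 \<le> \<rho>"
    and contr: "\<And>f l. 0 \<le> l \<Longrightarrow> lip f l \<Longrightarrow> lip (glauber f) (\<rho> * l)"
  shows "tv_dist L lam q t X \<le> real (L\<^sup>2) * \<rho> ^ t"
proof -
  obtain g where g: "centered wt g" "lip g 2" "2 * tv_dist L lam q t X = (glauber ^^ t) g X"
    using tv_dist_as_iterate[OF X] by metis
  have "lip ((glauber ^^ t) g) (\<rho> ^ t * 2) \<and> centered wt ((glauber ^^ t) g)"
  proof (induction t)
    case 0
    show ?case using g by simp
  next
    case (Suc t)
    then have "lip (glauber ((glauber ^^ t) g)) (\<rho> * (\<rho> ^ t * 2))"
      using \<rho> by (intro contr) auto
    moreover have "centered wt (glauber ((glauber ^^ t) g))"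
      using Suc by (intro block_avg_centered positive_wt finite_torus_V torus_V_nonempty) auto
    ultimately show ?case by (simp add: mult.assoc)
  qed
  then have "\<bar>(glauber ^^ t) g X\<bar> \<le> real (L\<^sup>2) * (\<rho> ^ t * 2)"
    using lip_mean_deviation[OF positive_wt _ X, of "(glauber ^^ t) g" "\<rho> ^ t * 2"]
    by (simp add: centered_def card_torus_V)
  then show ?thesis using g(3) by simp
qed

text \<open>A value at one configuration is recovered from the norm because every weight is at least
  1. The initial norm is bounded by the partition function, which brings in
  \<open>q\<close>.\<close>

lemma tv_dist_le_of_gap:
  assumes X: "X \<in> Om" and \<rho>: "0 \<le> \<rho>"
    and gap: "\<And>f. centered wt f \<Longrightarrow> ip wt f (glauber f) \<le> \<rho> * ip wt f f"
  shows "(2 * tv_dist L lam q t X)\<^sup>2 \<le> \<rho> ^ t * (real q * lam\<^sup>2) ^ (L\<^sup>2)"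
proof -
  obtain g where g: "centered wt g" "ip wt g g \<le> (\<Sum>Y\<in>Om. wt Y)"
      "2 * tv_dist L lam q t X = (glauber ^^ t) g X"
    using tv_dist_as_iterate[OF X] by metis
  let ?h = "(glauber ^^ t) g"
  have nn: "0 \<le> wt Y * ?h Y * ?h Y" for Y
    using mult_nonneg_nonneg[OF less_imp_le[OF wt_pos] zero_le_square] by (simp add: mult.assoc)
  have "(?h X)\<^sup>2 \<le> wt X * (?h X)\<^sup>2"
    using wt_ge_1[of X] by (simp add: mult_le_cancel_right1)
  also have "\<dots> = wt X * ?h X * ?h X" by (simp add: power2_eq_square)
  also have "\<dots> \<le> ip wt ?h ?h"
    unfolding ip_def using X nn by (intro member_le_sum[of X Om "\<lambda>Y. wt Y * ?h Y * ?h Y"]) simp_all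
  also have "\<dots> \<le> \<rho> ^ t * ip wt g g"
    by (rule gap_imp_decay[OF positive_wt finite_torus_V torus_V_nonempty \<rho> gap g(1)])
  also have "\<dots> \<le> \<rho> ^ t * (real q * lam\<^sup>2) ^ (L\<^sup>2)"
    using g(2) total_wt_le \<rho> by (intro mult_left_mono) auto
  finally show ?thesis unfolding g(3) .
qed

lemma mixing_time_le:
  assumes "\<And>X. X \<in> Om \<Longrightarrow> tv_dist L lam q t X \<le> \<epsilon>"
  shows "mixing_time L lam q \<epsilon> \<le> t"
  unfolding mixing_time_def Om_configs[symmetric]
  using assms Om_nonempty by (subst Max_le_iff) (auto intro: Least_le)

lemma block_1: "p \<in> torus_V L \<Longrightarrow> block L 1 p = {p}"
  by (cases p) (simp add: block_def torus_V_def lessThan_Suc)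

text \<open>For \<open>r = 1\<close> the exponent \<open>2 + 2 / r\<close> is 4 and the contraction
  hypothesis reads \<open>96 * lam ^ 4 \<le> q\<close>; 128 leaves some room.\<close>

lemma glauber_contraction:
  assumes q: "128 * lam ^ 4 \<le> real q" and l: "0 \<le> l" and f: "lip f l"
  shows "lip (glauber f) ((1 - 1 / (2 * real (L\<^sup>2))) * l)"
proof -
  have "weight_ratio 1 = lam ^ 4 / real q"
    using lam_gt powr_realpow[of lam 4] by (simp add: weight_ratio_def)
  then have "24 * real (1\<^sup>2) * 2 ^ (1\<^sup>2 + 1) * weight_ratio 1 \<le> 1"
    using q q_pos lam_gt zero_less_power[of lam 4] by (simp add: divide_le_eq) 
  then have "lip (block_avg wt (torus_V L) (block L 1) f) ((1 - real (1\<^sup>2) / (2 * real (L\<^sup>2))) * l)"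
    using L_ge l f by (intro block_contraction) auto
  moreover have "block_avg wt (torus_V L) (block L 1) f = glauber f"
    unfolding block_avg_def using block_1 by (intro ext arg_cong2[where f = "(/)"] sum.cong refl) metis
  ultimately show ?thesis by simp
qed

text \<open>The block gap is \<open>r^2\<close> times \<open>1 / (2 * L^2)\<close> and every site
  lies in \<open>r^2\<close> blocks, so only the comparison factor \<open>lam ^ (4 * r^2)\<close> is
  lost.\<close>

lemma glauber_gap:
  assumes r: "1 \<le> r" "r \<le> L" and x: "24 * real (r\<^sup>2) * 2 ^ (r\<^sup>2 + 1) * weight_ratio r \<le> 1"
    and f: "centered wt f"
  shows "ip wt f (glauber f) \<le> (1 - 1 / (2 * real (L\<^sup>2)) / lam ^ (4 * r\<^sup>2)) * ip wt f f"
proof (rule block_gap_imp_single_site_gap[where J = "torus_V L" and B = "block L r" and d = "r\<^sup>2"])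
  have "r\<^sup>2 \<le> L\<^sup>2" using r by (intro power_mono) auto
  then have le: "real (r\<^sup>2) \<le> real (L\<^sup>2)" by (rule of_nat_mono)
  have n: "0 < real (L\<^sup>2)" using L_ge by simp
  have "ip wt f (block_avg wt (torus_V L) (block L r) f)
      \<le> (1 - real (r\<^sup>2) / (2 * real (L\<^sup>2))) * ip wt f f"
  proof (rule lip_contraction_imp_gap[OF positive_wt finite_torus_V torus_V_nonempty _ _ f])
    have "real (r\<^sup>2) < 2 * real (L\<^sup>2)" using le n by linarith
    then show "0 < 1 - real (r\<^sup>2) / (2 * real (L\<^sup>2))" using n by (simp del: of_nat_power)
  qed (rule block_contraction[OF r x])
  then show "ip wt f (block_avg wt (torus_V L) (block L r) f)
      \<le> (1 - real (r\<^sup>2) * (1 / (2 * real (L\<^sup>2)))) * ip wt f f" by simp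
  show "wt X \<le> lam ^ (4 * r\<^sup>2) * wt Y" if "X \<in> Om" "Y \<in> cls (block L r p) X" for p X Y
  proof -
    have "wt X \<le> lam ^ (4 * card (block L r p)) * wt Y"
      using that(2) L_ge by (intro wt_cls_ratio block_subset) auto
    also have "\<dots> \<le> lam ^ (4 * r\<^sup>2) * wt Y"
      using card_block_le[of L r p] lam_gt wt_pos[of Y]
      by (intro mult_right_mono power_increasing) auto
    finally show ?thesis .
  qed
qed (use L_ge r lam_gt in \<open>simp_all add: positive_wt torus_V_nonempty block_subset card_blocks_containing\<close>)

lemma mixing_time_bound:
  fixes r :: nat and \<epsilon> :: real
  assumes r: "1 \<le> r" "r \<le> L"
    and qbig: "2 ^ (r\<^sup>2 + 8 * r + 3) * lam powr (2 + 2 / real r) \<le> real q"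
    and \<epsilon>: "0 < \<epsilon>" "\<epsilon> < 1"
  shows "real (mixing_time L lam q \<epsilon>) \<le>
     4 * (4 * lam ^ 8) ^ (r\<^sup>2 + 1) * (real L ^ 2) ^ 2 * ln (2 * exp 1 * real L ^ 2) *
     (real L ^ 2 * ln (4 * lam ^ 6) + ln (1 / \<epsilon>))"
proof -
  define n where "n = real L ^ 2"
  define \<Lambda> where "\<Lambda> = lam powr (2 + 2 / real r)"
  define M where "M = n * ln (4 * lam ^ 6) + ln (1 / \<epsilon>)"
  define K where "K = lam ^ (4 * r\<^sup>2)"
  define T where "T = 4 * (4 * lam ^ 8) ^ (r\<^sup>2 + 1) * n\<^sup>2 * ln (2 * exp 1 * n) * M"
  define t where "t = nat \<lfloor>T\<rfloor>"
  have \<Lambda>: "0 < \<Lambda>" using lam_gt by (simp add: \<Lambda>_def)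
  have nL: "n = real (L\<^sup>2)" by (simp add: n_def)
  have n1: "1 \<le> n" unfolding n_def using L_ge by (intro one_le_power) simp
  have K1: "1 \<le> K" unfolding K_def using lam_gt by (intro one_le_power) simp
  have lam6: "1 \<le> lam ^ 6" using lam_gt by (intro one_le_power) simp
  have ln4: "1 \<le> ln (4 * lam ^ 6)"
  proof -
    have "exp 1 \<le> 4 * lam ^ 6" using exp_le lam6 by linarith
    then show ?thesis using lam6 by (subst ln_ge_iff) auto
  qed
  have l\<epsilon>: "0 \<le> ln (1 / \<epsilon>)" using \<epsilon> by simp
  have nM: "n + ln (1 / \<epsilon>) \<le> M"
    unfolding M_def using n1 ln4 by (simp add: mult_le_cancel_left1)
  have M1: "1 \<le> M" using nM n1 l\<epsilon> by linarith
  have KnM1: "1 \<le> K * n * M"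
    using mult_mono[of 1 K 1 n] mult_mono[of 1 "K * n" 1 M] K1 n1 M1 by simp
  have "64 * (K * n * M) \<le> T"
    unfolding K_def T_def using M1 by (intro bound_dominates lam_gt r(1) n1) simp
  \<comment> \<open>\<open>t\<close> is \<open>T\<close> rounded down, the mixing time being an
    integer; the surplus of 64 over 8, with \<open>K * n * M \<ge> 1\<close>, makes up for the
    rounding.\<close>
  moreover have "T < real t + 1"
    unfolding t_def using calculation KnM1 by linarith
  ultimately have t: "8 * (K * n * M) \<le> real t" using KnM1 by linarith
  have tT: "real t \<le> T"
    unfolding t_def using \<open>64 * (K * n * M) \<le> T\<close> KnM1 by linarith
  have exp_bound: "(1 - x) ^ t \<le> exp (- (x * real t))" if "x \<le> 1" for x :: real
  proof -
    have "(1 - x) ^ t \<le> exp (- x) ^ t"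
      using that exp_ge_add_one_self[of "- x"] by (intro power_mono) auto
    also have "\<dots> = exp (- (x * real t))" by (simp add: exp_of_nat_mult[symmetric] mult.commute)
    finally show ?thesis .
  qed
  have "mixing_time L lam q \<epsilon> \<le> t"
  proof (rule mixing_time_le)
    fix X assume X: "X \<in> Om"
    show "tv_dist L lam q t X \<le> \<epsilon>"
    proof (cases "128 * lam ^ 4 \<le> real q")
      case True
      have half: "1 / (2 * n) \<le> 1" using n1 by simp
      have "tv_dist L lam q t X \<le> n * (1 - 1 / (2 * n)) ^ t"
        unfolding nL
        by (rule tv_dist_le_of_contraction[OF X _ glauber_contraction[OF True]])
          (use half in \<open>simp add: nL\<close>)
      also have "\<dots> \<le> n * exp (- (1 / (2 * n) * real t))"
        using n1 exp_bound[OF half] by (intro mult_left_mono) auto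
      \<comment> \<open>The extra \<open>ln n\<close> in the exponent cancels the prefactor
        \<open>n\<close>; \<open>M\<close> covers it because \<open>ln n \<le> n\<close> and
        \<open>ln (4 * lam ^ 6) \<ge> 1\<close>.\<close>
      also have "\<dots> \<le> n * exp (- (ln n + ln (1 / \<epsilon>)))"
      proof -
        have "ln n \<le> n" using ln_le_minus_one[of n] n1 by simp
        then have "ln n + ln (1 / \<epsilon>) \<le> M" using nM by linarith
        then have "(ln n + ln (1 / \<epsilon>)) * (2 * n) \<le> M * (2 * n)"
          using n1 by (intro mult_right_mono) auto
        also have "\<dots> \<le> 8 * (K * n * M)"
          using mult_mono[of 1 K "n * M" "n * M"] K1 n1 M1 by (simp add: mult_ac)
        finally have "(ln n + ln (1 / \<epsilon>)) * (2 * n) \<le> real t" using t by linarith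
        then have "ln n + ln (1 / \<epsilon>) \<le> 1 / (2 * n) * real t"
          using n1 by (simp add: pos_le_divide_eq)
        then show ?thesis using n1 by (intro mult_left_mono) auto
      qed
      also have "\<dots> = \<epsilon>"
        using n1 \<epsilon>(1) by (simp add: exp_diff exp_minus ln_div)
      finally show ?thesis .
    next
      case False
      have x: "24 * real (r\<^sup>2) * 2 ^ (r\<^sup>2 + 1) * weight_ratio r \<le> 1"
      proof -
        have "24 * r\<^sup>2 * 2 ^ (r\<^sup>2 + 1) = (6 * r\<^sup>2) * 2 ^ (r\<^sup>2 + 3)" by (simp add: power_add)
        also have "\<dots> \<le> 2 ^ (8 * r) * 2 ^ (r\<^sup>2 + 3)"
          using six_square_le[OF r(1)] by (rule mult_right_mono) simp
        also have "\<dots> = 2 ^ (r\<^sup>2 + 8 * r + 3)" by (simp add: power_add mult_ac)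
        finally have "24 * r\<^sup>2 * 2 ^ (r\<^sup>2 + 1) \<le> 2 ^ (r\<^sup>2 + 8 * r + 3)" .
        then have "real (24 * r\<^sup>2 * 2 ^ (r\<^sup>2 + 1)) \<le> real (2 ^ (r\<^sup>2 + 8 * r + 3))"
          by (rule of_nat_mono)
        then have "24 * real (r\<^sup>2) * 2 ^ (r\<^sup>2 + 1) \<le> 2 ^ (r\<^sup>2 + 8 * r + 3)"
          by (simp only: of_nat_mult of_nat_power of_nat_numeral)
        then have "24 * real (r\<^sup>2) * 2 ^ (r\<^sup>2 + 1) * \<Lambda> \<le> 2 ^ (r\<^sup>2 + 8 * r + 3) * \<Lambda>"
          using \<Lambda> by (intro mult_right_mono) auto
        also have "\<dots> \<le> real q" using qbig by (simp only: \<Lambda>_def)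
        finally show ?thesis using q_pos by (simp add: weight_ratio_def \<Lambda>_def)
      qed
      define \<gamma> where "\<gamma> = 1 / (2 * n) / K"
      have \<gamma>1: "\<gamma> \<le> 1"
      proof -
        have "1 \<le> 2 * n * K" using mult_mono[of 1 "2 * n" 1 K] n1 K1 by simp
        then show ?thesis using n1 K1 by (simp add: \<gamma>_def)
      qed
      have "(2 * tv_dist L lam q t X)\<^sup>2 \<le> (1 - \<gamma>) ^ t * (real q * lam\<^sup>2) ^ (L\<^sup>2)"
        unfolding \<gamma>_def nL K_def
        by (rule tv_dist_le_of_gap[OF X _ glauber_gap[OF r x]])
          (use \<gamma>1 in \<open>simp add: \<gamma>_def nL K_def\<close>)
      also have "\<dots> \<le> exp (- (\<gamma> * real t)) * exp (4 * (n * ln (4 * lam ^ 6)))"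
      proof (rule mult_mono[OF exp_bound[OF \<gamma>1]])
        \<comment> \<open>Origin of \<open>ln (4 * lam ^ 6)\<close>: below the threshold
          \<open>q * lam^2\<close> is at most \<open>128 * lam ^ 6\<close>, which the fourth power
          of \<open>4 * lam ^ 6\<close> exceeds since \<open>4 ^ 4 = 256\<close>.\<close>
        have "real q * lam\<^sup>2 \<le> 128 * lam ^ 4 * lam\<^sup>2"
          using False by (intro mult_right_mono) auto
        also have "\<dots> = 128 * lam ^ 6" by (simp flip: power_add)
        also have "\<dots> \<le> 256 * (lam ^ 6) ^ 4"
          using lam6 power_increasing[of 1 4 "lam ^ 6"] by simp
        also have "\<dots> = (4 * lam ^ 6) ^ 4" by (simp add: power_mult_distrib)
        finally have "(real q * lam\<^sup>2) ^ (L\<^sup>2) \<le> ((4 * lam ^ 6) ^ 4) ^ (L\<^sup>2)"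
          by (intro power_mono) auto
        also have "\<dots> = exp (ln (4 * lam ^ 6)) ^ (4 * L\<^sup>2)"
        proof -
          have "0 < 4 * lam ^ 6" using lam6 by linarith
          then show ?thesis by (simp only: power_mult exp_ln)
        qed
        also have "\<dots> = exp (4 * (n * ln (4 * lam ^ 6)))"
          by (simp add: nL exp_of_nat_mult[symmetric] mult.assoc)
        finally show "(real q * lam\<^sup>2) ^ (L\<^sup>2) \<le> exp (4 * (n * ln (4 * lam ^ 6)))" .
      qed auto
      also have "\<dots> = exp (4 * (n * ln (4 * lam ^ 6)) - \<gamma> * real t)"
        by (simp flip: exp_add)
      also have "\<dots> \<le> exp (2 * ln \<epsilon>)"
      proof -
        \<comment> \<open>As \<open>\<gamma>\<close> is \<open>1 / (2 * n * K)\<close>, time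
          \<open>8 * (K * n * M)\<close> buys the exponent \<open>4 * M\<close>, enough for both the
          initial norm and \<open>\<epsilon>^2\<close>.\<close>
        have "4 * M = \<gamma> * (8 * (K * n * M))" using n1 K1 by (simp add: \<gamma>_def)
        also have "\<dots> \<le> \<gamma> * real t"
          using t n1 K1 by (intro mult_left_mono) (auto simp: \<gamma>_def)
        finally have "4 * (n * ln (4 * lam ^ 6)) - \<gamma> * real t \<le> - 4 * ln (1 / \<epsilon>)"
          by (simp add: M_def)
        also have "\<dots> \<le> - 2 * ln (1 / \<epsilon>)" using l\<epsilon> by simp
        also have "\<dots> = 2 * ln \<epsilon>" using \<epsilon>(1) by (simp add: ln_div)
        finally show ?thesis by simp
      qed
      also have "\<dots> = \<epsilon>\<^sup>2"
        using \<epsilon>(1) exp_of_nat_mult[of 2 "ln \<epsilon>"] by simp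
      finally have "2 * tv_dist L lam q t X \<le> \<epsilon>"
        by (rule power2_le_imp_le) (use \<epsilon>(1) in simp)
      then show ?thesis using \<epsilon>(1) by linarith
    qed
  qed
  then have "real (mixing_time L lam q \<epsilon>) \<le> T" using tT by linarith
  then show ?thesis by (simp only: T_def M_def n_def)
qed

end

theorem theorem2p15:
  fixes L q r :: nat and lam \<epsilon> :: real
  assumes "lam > 1"
    and "r \<ge> 1" and "r + 2 \<le> L"
    and "real q \<ge> 2 ^ (r^2 + 8*r + 3) * real r ^ (2*r^2 + 4*r + 1) * lam powr (2 + 2 / real r)"
    and "\<epsilon> > 0" and "\<epsilon> < 1"
  shows "real (mixing_time L lam q \<epsilon>) \<le>
     4 * (4 * lam ^ 8) ^ (r^2 + 1) * (real L ^ 2) ^ 2 * ln (2 * exp 1 * real L ^ 2) *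
     (real L ^ 2 * ln (4 * lam ^ 6) + ln (1 / \<epsilon>))"
proof -
  have "1 \<le> real r ^ (2*r^2 + 4*r + 1)" using assms(2) by (intro one_le_power) simp
  then have "2 ^ (r^2 + 8*r + 3) * 1 * lam powr (2 + 2 / real r)
      \<le> 2 ^ (r^2 + 8*r + 3) * real r ^ (2*r^2 + 4*r + 1) * lam powr (2 + 2 / real r)"
    by (intro mult_right_mono mult_left_mono) auto
  then have q: "2 ^ (r^2 + 8*r + 3) * lam powr (2 + 2 / real r) \<le> real q"
    using assms(4) by linarith
  have "0 < 2 ^ (r^2 + 8*r + 3) * lam powr (2 + 2 / real r)" using assms(1) by simp
  then have "0 < q" using q by (metis less_le_trans of_nat_0_less_iff)
  then have "potts L q lam"
    using assms(1,3) by (intro potts.intro) auto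
  then show ?thesis
    by (rule potts.mixing_time_bound) (use assms q in auto)
qed

end
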